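(* Let $n\ge 1$ be an integer, and for a positive integer $r$ let $\rho_r:\operatorname{Toep}_n^r(\mathbb{C})\rightarrow\mathbb{C}^{n\times n}$ be the map defined by $\rho_r(T_{n-r},\dots,T_{n-1})=T_{n-r}\cdots T_{n-1}$. When $r\ge\lfloor n/2\rfloor+1$, for a generic point $\tau=(T_{n-r},\dots,T_{n-1})\in\operatorname{Toep}_n^r(\mathbb{C})$ the differential of $\rho_r$ at $\tau$ is of full rank $n^2$. Therefore, for a generic $A\in\mathbb{C}^{n\times n}$, there exist $r=\lfloor n/2\rfloor+1$ Toeplitz matrices $T_1,\dots,T_r\in\operatorname{Toep}_n(\mathbb{C})$ such that $A=T_1\cdots T_r$.
   Context: $\operatorname{Toep}_n(\mathbb{C})\simeq\mathbb{C}^{2n-1}$ is the linear subspace of $\mathbb{C}^{n\times n}$ of Toeplitz matrices, i.e. matrices $(a_{i,j})$ whose entries are constant along diagonals ($a_{i,j}$ depends only on $j-i$). $\operatorname{Toep}_n^r(\mathbb{C})$ is the product of $r$ copies of $\operatorname{Toep}_n(\mathbb{C})$; its $r$ coordinates are indexed $n-r,\dots,n-1$. The differential of $\rho_r$ at $\tau=(T_{n-r},\dots,T_{n-1})$ is the linear map $\operatorname{Toep}_n^r(\mathbb{C})\to\mathbb{C}^{n\times n}$, $(X_{n-r},\dots,X_{n-1})\mapsto\sum_{i=1}^r T_{n-r}\cdots T_{n-i-1}X_{n-i}T_{n-i+1}\cdots T_{n-1}$. A property holds for a generic point of an irreducible algebraic variety $X$ if the Zariski closure of the set of points of $X$ not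 having the property is a proper closed subset of $X$. *)

theory Defs
  imports
    "HOL-Analysis.Abstract_Topology"
    "Jordan_Normal_Form.VS_Connect"
begin

section \<open>Toeplitz matrices and products of Toeplitz matrices\<close>

definition Toep :: "nat \<Rightarrow> complex mat set" where
  "Toep n = {A \<in> carrier_mat n n.
     \<forall>i<n. \<forall>j<n. \<forall>i'<n. \<forall>j'<n.
       int j - int i = int j' - int i' \<longrightarrow> A $$ (i, j) = A $$ (i', j')}"

text \<open>
  A tuple \<open>(T_{n-r}, ..., T_{n-1})\<close> is a list of length \<open>r\<close>; the matrix
  \<open>T_{n-i}\<close>, for \<open>1 \<le> i \<le> r\<close>, sits at list position \<open>r - i\<close>.
\<close>

definition Toep_tuples :: "nat \<Rightarrow> nat \<Rightarrow> complex mat list set" where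
  "Toep_tuples n r = {Ts. length Ts = r \<and> set Ts \<subseteq> Toep n}"

definition mat_prod :: "nat \<Rightarrow> complex mat list \<Rightarrow> complex mat" where
  "mat_prod n Ts = foldr (*) Ts (1\<^sub>m n)"

text \<open>
  Each summand below is
  \<open>T_{n-r} \<cdots> T_{n-i-1} X_{n-i} T_{n-i+1} \<cdots> T_{n-1}\<close>.
\<close>

definition mat_prod_differential ::
    "nat \<Rightarrow> complex mat list \<Rightarrow> complex mat list \<Rightarrow> complex mat" where
  "mat_prod_differential n Ts Xs =
     (let r = length Ts in
      (\<Oplus>\<^bsub>module_mat TYPE(complex) n n\<^esub> i\<in>{1..r}.
         mat_prod n (take (r - i) Ts) * Xs ! (r - i) * mat_prod n (drop (r - i + 1) Ts)))"

text \<open>The rank of a linear map from \<open>D\<close> to the \<open>n \<times> n\<close> matrices: the dimension of its image.\<close>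

definition rank_on :: "nat \<Rightarrow> 'a set \<Rightarrow> ('a \<Rightarrow> complex mat) \<Rightarrow> nat" where
  "rank_on n D f =
     vectorspace.dim class_ring ((module_mat TYPE(complex) n n)\<lparr>carrier := f ` D\<rparr>)"

section \<open>Zariski topology and generic points\<close>

text \<open>The algebra of functions generated by the coordinate functions in \<open>C\<close>.\<close>

inductive_set polynomial_functions ::
    "('a \<Rightarrow> complex) set \<Rightarrow> ('a \<Rightarrow> complex) set" for C where
  const: "(\<lambda>_. c) \<in> polynomial_functions C"
| coord: "x \<in> C \<Longrightarrow> x \<in> polynomial_functions C"
| add: "f \<in> polynomial_functions C \<Longrightarrow> g \<in> polynomial_functions C \<Longrightarrow>
    (\<lambda>p. f p + g p) \<in> polynomial_functions C"
| mult: "f \<in> polynomial_functions C \<Longrightarrow> g \<in> polynomial_functions C \<Longrightarrow>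
    (\<lambda>p. f p * g p) \<in> polynomial_functions C"

definition zero_locus :: "'a set \<Rightarrow> ('a \<Rightarrow> complex) set \<Rightarrow> 'a set" where
  "zero_locus X F = {p \<in> X. \<forall>f\<in>F. f p = 0}"

definition zariski :: "('a \<Rightarrow> complex) set \<Rightarrow> 'a set \<Rightarrow> 'a topology" where
  "zariski C X = topology (\<lambda>U. \<exists>F\<subseteq>polynomial_functions C. U = X - zero_locus X F)"

lemma istopology_zariski:
  "istopology (\<lambda>U. \<exists>F\<subseteq>polynomial_functions C. U = X - zero_locus X F)"
  (is "istopology ?L")
  unfolding istopology_def
proof (intro conjI allI impI)
  fix S T assume "?L S" "?L T"
  then obtain F G where F: "F \<subseteq> polynomial_functions C" "S = X - zero_locus X F"
    and G: "G \<subseteq> polynomial_functions C" "T = X - zero_locus X G" by blast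
  let ?H = "(\<lambda>(f, g) p. f p * g p) ` (F \<times> G)"
  have "?H \<subseteq> polynomial_functions C"
    using F(1) G(1) by (auto intro!: polynomial_functions.mult)
  moreover have "S \<inter> T = X - zero_locus X ?H"
    unfolding F(2) G(2) zero_locus_def by auto
  ultimately show "?L (S \<inter> T)" by blast
next
  fix K assume "\<forall>U\<in>K. ?L U"
  then obtain F where F: "\<And>U. U \<in> K \<Longrightarrow> F U \<subseteq> polynomial_functions C \<and> U = X - zero_locus X (F U)"
    by metis
  have U: "p \<in> U \<longleftrightarrow> p \<in> X \<and> (\<exists>f\<in>F U. f p \<noteq> 0)" if "U \<in> K" for U p
  proof -
    have "p \<in> U \<longleftrightarrow> p \<in> X - zero_locus X (F U)" using F[OF that] by blast
    then show ?thesis by (auto simp: zero_locus_def)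
  qed
  have "\<Union>K = X - zero_locus X (\<Union>(F ` K))"
  proof (rule Set.set_eqI)
    fix p
    have "p \<in> \<Union>K \<longleftrightarrow> (\<exists>U\<in>K. p \<in> X \<and> (\<exists>f\<in>F U. f p \<noteq> 0))" using U by auto
    also have "\<dots> \<longleftrightarrow> p \<in> X - zero_locus X (\<Union>(F ` K))" by (auto simp: zero_locus_def)
    finally show "p \<in> \<Union>K \<longleftrightarrow> p \<in> X - zero_locus X (\<Union>(F ` K))" .
  qed
  moreover have "\<Union>(F ` K) \<subseteq> polynomial_functions C" using F by blast
  ultimately show "?L (\<Union>K)" by blast
qed

lemma openin_zariski:
  "openin (zariski C X) U \<longleftrightarrow> (\<exists>F\<subseteq>polynomial_functions C. U = X - zero_locus X F)"
  unfolding zariski_def by (simp add: topology_inverse' istopology_zariski)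

lemma topspace_zariski [simp]: "topspace (zariski C X) = X"
proof
  show "topspace (zariski C X) \<subseteq> X" by (auto simp: topspace_def openin_zariski)
  have "zero_locus X {\<lambda>_. 1} = {}" by (auto simp: zero_locus_def)
  then have "openin (zariski C X) X"
    unfolding openin_zariski
    by (intro exI[of _ "{\<lambda>_. 1}"]) (simp add: polynomial_functions.const)
  then show "X \<subseteq> topspace (zariski C X)" by (rule openin_subset)
qed

lemma closedin_zariski:
  "closedin (zariski C X) S \<longleftrightarrow> (\<exists>F\<subseteq>polynomial_functions C. S = zero_locus X F)"
proof -
  have sub: "zero_locus X F \<subseteq> X" for F by (auto simp: zero_locus_def)
  have "S \<subseteq> X \<and> X - S = X - zero_locus X F \<longleftrightarrow> S = zero_locus X F" for F
    using sub[of F] by blast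
  then show ?thesis
    unfolding closedin_def topspace_zariski openin_zariski by blast
qed

text \<open>
  \<open>P\<close> holds for a generic point of the variety \<open>X\<close>, whose coordinate functions are \<open>C\<close>.
  The notion is meant for irreducible \<open>X\<close>; below, \<open>X\<close> is always a linear space.
\<close>

definition generic :: "('a \<Rightarrow> complex) set \<Rightarrow> 'a set \<Rightarrow> ('a \<Rightarrow> bool) \<Rightarrow> bool" where
  "generic C X P \<longleftrightarrow> zariski C X closure_of {p \<in> X. \<not> P p} \<subset> X"

text \<open>
  Coordinates on the linear spaces at hand are matrix entries. On Toeplitz tuples some of them
  coincide, so that \<open>r * (2 * n - 1)\<close> distinct ones remain on \<open>Toep_tuples n r\<close>.
\<close>

definition mat_coords :: "nat \<Rightarrow> (complex mat \<Rightarrow> complex) set" where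
  "mat_coords n = {\<lambda>A. A $$ (i, j) | i j. i < n \<and> j < n}"

definition tuple_coords :: "nat \<Rightarrow> nat \<Rightarrow> (complex mat list \<Rightarrow> complex) set" where
  "tuple_coords n r = {\<lambda>Ts. Ts ! k $$ (i, j) | k i j. k < r \<and> i < n \<and> j < n}"

end

theory Submission
  imports Defs "HOL-Computational_Algebra.Fundamental_Theorem_Algebra"
begin

text \<open>
  Both parts follow from one fact: for \<open>r \<ge> \<lfloor>n/2\<rfloor> + 1\<close> there is a tuple of Toeplitz matrices at which the
  differential of the product map is surjective (\<open>exists_surjective_differential\<close>).
  
  Such a point is found near the tuple of identity matrices, at \<open>T\<^sub>k = 1 + \<epsilon> S\<^sub>k\<close>. At \<open>\<epsilon> = 0\<close> the image of
  the differential consists of the Toeplitz matrices only. Moving two neighbouring factors by \<open>Y\<close> and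
  \<open>-Y\<close> cancels to zeroth order in \<open>\<epsilon>\<close> and contributes \<open>Y S\<^sub>k\<^sub>+\<^sub>1 - S\<^sub>k Y\<close> to first order. So it suffices
  that these commutator-like matrices, together with the Toeplitz matrices, span everything. The
  displacement operator \<open>A\<^sub>i\<^sub>+\<^sub>1\<^sub>,\<^sub>j\<^sub>+\<^sub>1 - A\<^sub>i\<^sub>,\<^sub>j\<close> has the Toeplitz matrices as its kernel and turns products of
  Toeplitz matrices into matrices of rank at most two. After reversing columns the question becomes one
  about expressions \<open>a u'\<^sup>T + u a\<^sup>T + b v'\<^sup>T + v b\<^sup>T\<close> with \<open>a\<close>, \<open>b\<close> arbitrary and the chains \<open>u\<close>, \<open>v\<close> at our
  disposal. Chains that run once around the standard basis of \<open>\<complex>\<^sup>n\<^sup>-\<^sup>1\<close> and return to a multiple of the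
  first vector do the job (\<open>toeplitz_commutators_generate\<close>); their length is what requires
  \<open>\<lfloor>n/2\<rfloor> + 1\<close> factors.
  
  Full rank at one point implies full rank generically, since an \<open>n\<^sup>2 \<times> n\<^sup>2\<close> determinant is a polynomial
  (\<open>spanning_near_matrix_units\<close>). For the factorization, surjectivity of the differential shows that no
  nontrivial polynomial vanishes on the image of the product map
  (\<open>polynomial_vanishing_along_all_directions\<close>). By Chevalley's theorem, proved here by eliminating one
  variable after the other (\<open>constructible_exists_common_root\<close>), the image is constructible; not being
  contained in a hypersurface, it contains a nonempty Zariski-open set (\<open>dominant_image_contains_open\<close>).
\<close>

section \<open>Polynomial functions\<close>

lemma polynomial_functions_sum:
  assumes "\<And>i. i \<in> A \<Longrightarrow> f i \<in> polynomial_functions C"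
  shows "(\<lambda>p. \<Sum>i\<in>A. f i p) \<in> polynomial_functions C"
  using assms
  by (induction A rule: infinite_finite_induct)
    (auto intro: polynomial_functions.const polynomial_functions.add)

lemma polynomial_functions_prod:
  assumes "\<And>i. i \<in> A \<Longrightarrow> f i \<in> polynomial_functions C"
  shows "(\<lambda>p. \<Prod>i\<in>A. f i p) \<in> polynomial_functions C"
  using assms
  by (induction A rule: infinite_finite_induct)
    (auto intro: polynomial_functions.const polynomial_functions.mult)

lemma polynomial_functions_diff:
  assumes "f \<in> polynomial_functions C" "g \<in> polynomial_functions C"
  shows "(\<lambda>p. f p - g p) \<in> polynomial_functions C"
proof -
  have "(\<lambda>p. f p + (- 1) * g p) \<in> polynomial_functions C"
    by (intro polynomial_functions.intros assms)
  then show ?thesis by simp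
qed

lemma polynomial_functions_compose:
  assumes "f \<in> polynomial_functions C"
    and "\<And>x. x \<in> C \<Longrightarrow> (\<lambda>q. x (\<gamma> q)) \<in> polynomial_functions C'"
  shows "(\<lambda>q. f (\<gamma> q)) \<in> polynomial_functions C'"
  using assms(1)
  by induction (auto intro: assms(2) polynomial_functions.intros)

lemma polynomial_functions_one_variable:
  "f \<in> polynomial_functions {\<lambda>t. t} \<longleftrightarrow> (\<exists>p. f = poly p)"
proof
  assume "f \<in> polynomial_functions {\<lambda>t. t}"
  then show "\<exists>p. f = poly p"
  proof induction
    case (const c)
    then show ?case by (intro exI[of _ "[:c:]"]) auto
  next
    case (coord x)
    then show ?case by (intro exI[of _ "[:0, 1:]"]) auto
  next
    case (add f g)
    then obtain p q where "f = poly p" "g = poly q" by blast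
    then show ?case by (intro exI[of _ "p + q"]) auto
  next
    case (mult f g)
    then obtain p q where "f = poly p" "g = poly q" by blast
    then show ?case by (intro exI[of _ "p * q"]) auto
  qed
next
  assume "\<exists>p. f = poly p"
  then obtain p where f: "f = poly p" ..
  have "(\<lambda>t. t ^ i) \<in> polynomial_functions {\<lambda>t. t}" for i :: nat
    by (induction i)
      (auto intro: polynomial_functions.const polynomial_functions.mult polynomial_functions.coord)
  then have "(\<lambda>t. \<Sum>i\<le>degree p. coeff p i * t ^ i) \<in> polynomial_functions {\<lambda>t. t}"
    by (intro polynomial_functions_sum polynomial_functions.mult polynomial_functions.const)
  then show "f \<in> polynomial_functions {\<lambda>t. t}"
    unfolding f by (simp add: poly_altdef[abs_def])
qed

text \<open>
  A nonzero polynomial in one variable has finitely many roots. This is the only limit argument of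
  the theory: what is known for all \<open>t \<noteq> 0\<close> passes to \<open>t = 0\<close>.
\<close>

lemma polynomial_function_eq_0_by_continuity:
  assumes "f \<in> polynomial_functions {\<lambda>t. t}" "\<And>t. t \<noteq> 0 \<Longrightarrow> f t = 0"
  shows "f 0 = 0"
proof -
  obtain p where p: "f = poly p" using assms(1) polynomial_functions_one_variable by blast
  have "UNIV - {0} \<subseteq> {t. poly p t = 0}" using assms(2) p by auto
  moreover have "infinite (UNIV - {0::complex})"
    by (simp add: infinite_UNIV_char_0)
  ultimately have "p = 0" using poly_roots_finite finite_subset by metis
  then show ?thesis using p by simp
qed

text \<open>
  A polynomial in one distinguished variable whose coefficients are polynomial functions of a
  parameter. The bound \<open>d\<close> is strict, so that \<open>d = 0\<close> forces the zero polynomial, and it is formal: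
  the leading coefficient may vanish for some parameters.
\<close>

definition polynomial_family :: "('a \<Rightarrow> complex) set \<Rightarrow> nat \<Rightarrow> ('a \<Rightarrow> complex poly) \<Rightarrow> bool" where
  "polynomial_family C d p \<longleftrightarrow>
     (\<forall>i. (\<lambda>e. coeff (p e) i) \<in> polynomial_functions C) \<and> (\<forall>e. \<forall>i\<ge>d. coeff (p e) i = 0)"

lemma polynomial_family_coeff:
  "polynomial_family C d p \<Longrightarrow> (\<lambda>e. coeff (p e) i) \<in> polynomial_functions C"
  by (simp add: polynomial_family_def)

lemma polynomial_family_mono:
  "polynomial_family C d p \<Longrightarrow> d \<le> d' \<Longrightarrow> polynomial_family C d' p"
  by (auto simp: polynomial_family_def)

lemma polynomial_family_const:
  assumes "f \<in> polynomial_functions C"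
  shows "polynomial_family C 1 (\<lambda>e. [:f e:])"
proof -
  have "(\<lambda>e. coeff [:f e:] i) \<in> polynomial_functions C" for i
    using assms by (cases i) (auto simp: polynomial_functions.const)
  then show ?thesis by (auto simp: polynomial_family_def coeff_pCons split: nat.split)
qed

lemma polynomial_family_variable: "polynomial_family C 2 (\<lambda>e. [:0, 1:])"
  by (auto simp: polynomial_family_def coeff_pCons polynomial_functions.const split: nat.split)

lemma polynomial_family_monom:
  assumes "f \<in> polynomial_functions C"
  shows "polynomial_family C (Suc k) (\<lambda>e. monom (f e) k)"
proof -
  have "(\<lambda>e. coeff (monom (f e) k) i) \<in> polynomial_functions C" for i
    using assms by (cases "k = i") (auto simp: polynomial_functions.const)
  then show ?thesis by (auto simp: polynomial_family_def)
qed

lemma polynomial_family_add: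
  assumes "polynomial_family C d p" "polynomial_family C d' q"
  shows "polynomial_family C (max d d') (\<lambda>e. p e + q e)"
  using assms by (auto simp: polynomial_family_def intro: polynomial_functions.add)

lemma polynomial_family_diff:
  assumes "polynomial_family C d p" "polynomial_family C d' q"
  shows "polynomial_family C (max d d') (\<lambda>e. p e - q e)"
  using assms by (auto simp: polynomial_family_def intro: polynomial_functions_diff)

lemma polynomial_family_mult:
  assumes p: "polynomial_family C d p" and q: "polynomial_family C d' q"
  shows "polynomial_family C (d + d') (\<lambda>e. p e * q e)"
  unfolding polynomial_family_def
proof (intro conjI allI impI)
  fix i
  show "(\<lambda>e. coeff (p e * q e) i) \<in> polynomial_functions C"
    unfolding coeff_mult
    by (intro polynomial_functions_sum polynomial_functions.mult
        polynomial_family_coeff[OF p] polynomial_family_coeff[OF q])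
next
  fix e i assume "d + d' \<le> i"
  then have "coeff (p e) j * coeff (q e) (i - j) = 0" for j
    using p q by (cases "d \<le> j") (auto simp: polynomial_family_def)
  then show "coeff (p e * q e) i = 0" unfolding coeff_mult by (intro sum.neutral) auto
qed

lemma polynomial_family_power:
  assumes "polynomial_family C d p"
  shows "\<exists>k. polynomial_family C k (\<lambda>e. p e ^ j)"
proof (induction j)
  case 0
  have "polynomial_family C 1 (\<lambda>e. [:1:])"
    by (rule polynomial_family_const[OF polynomial_functions.const])
  then show ?case by (auto simp: one_pCons)
next
  case (Suc j)
  then show ?case using polynomial_family_mult[OF assms] by fastforce
qed

text \<open>
  Substituting a polynomial curve \<open>t \<mapsto> \<gamma> z t\<close> into a polynomial function gives a polynomial in \<open>t\<close>;
  it suffices to check this on coordinates. The curves of interest are the lines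
  \<open>Y + t Z\<close> in a space of matrices, and the change of a single coordinate to \<open>t\<close>.
\<close>

lemma polynomial_function_along_curves:
  assumes "f \<in> polynomial_functions C"
    and coords: "\<And>x. x \<in> C \<Longrightarrow>
      \<exists>d p. polynomial_family C' d p \<and> (\<forall>z\<in>Z. \<forall>t. x (\<gamma> z t) = poly (p z) t)"
  shows "\<exists>d p. polynomial_family C' d p \<and> (\<forall>z\<in>Z. \<forall>t. f (\<gamma> z t) = poly (p z) t)"
  using assms(1)
proof induction
  case (const c)
  show ?case
    using polynomial_family_const[OF polynomial_functions.const, of C' c] by fastforce
next
  case (coord x)
  then show ?case by (rule coords)
next
  case (add f g)
  from add.IH obtain d p d' q
    where p: "polynomial_family C' d p" "\<forall>z\<in>Z. \<forall>t. f (\<gamma> z t) = poly (p z) t"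
      and q: "polynomial_family C' d' q" "\<forall>z\<in>Z. \<forall>t. g (\<gamma> z t) = poly (q z) t"
    by (elim exE conjE) (rule that)
  show ?case
    using polynomial_family_add[OF p(1) q(1)] p(2) q(2)
    by (intro exI conjI) (assumption, simp)
next
  case (mult f g)
  from mult.IH obtain d p d' q
    where p: "polynomial_family C' d p" "\<forall>z\<in>Z. \<forall>t. f (\<gamma> z t) = poly (p z) t"
      and q: "polynomial_family C' d' q" "\<forall>z\<in>Z. \<forall>t. g (\<gamma> z t) = poly (q z) t"
    by (elim exE conjE) (rule that)
  show ?case
    using polynomial_family_mult[OF p(1) q(1)] p(2) q(2)
    by (intro exI conjI) (assumption, simp)
qed

section \<open>Elimination of variables\<close>

text \<open>
  Long division by \<open>p\<close> without dividing by its leading coefficient: instead \<open>q\<close> is multiplied by that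
  coefficient at every step. Where the coefficient does not vanish, \<open>q\<close> and the remainder agree, up to a
  nonzero factor, modulo \<open>p\<close>.
\<close>

lemma pseudo_division:
  assumes p: "polynomial_family C (Suc d) p" and q: "polynomial_family C k q"
  shows "\<exists>r. polynomial_family C d r \<and>
    (\<forall>e. \<exists>s j. Polynomial.smult (coeff (p e) d ^ j) (q e) = p e * s + r e)"
  using q
proof (induction k arbitrary: q)
  case 0
  have "polynomial_family C d q" using polynomial_family_mono[OF 0] by simp
  moreover have "Polynomial.smult (coeff (p e) d ^ 0) (q e) = p e * 0 + q e" for e by simp
  ultimately show ?case by blast
next
  case (Suc k)
  show ?case
  proof (cases "Suc k \<le> d")
    case True
    have "polynomial_family C d q" using polynomial_family_mono[OF Suc.prems True] .
    moreover have "Polynomial.smult (coeff (p e) d ^ 0) (q e) = p e * 0 + q e" for e by simp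
    ultimately show ?thesis by blast
  next
    case False
    \<comment> \<open>One step of the division cancels the top coefficient of \<open>q\<close>.\<close>
    define m where "m e = monom (coeff (q e) k) (k - d)" for e
    define q' where "q' e = [:coeff (p e) d:] * q e - m e * p e" for e
    have m: "polynomial_family C (Suc (k - d)) m"
      unfolding m_def by (rule polynomial_family_monom[OF polynomial_family_coeff[OF Suc.prems]])
    have q': "polynomial_family C (max (1 + Suc k) (Suc (k - d) + Suc d)) q'"
      unfolding q'_def
      by (intro polynomial_family_diff polynomial_family_mult polynomial_family_const
          polynomial_family_coeff[OF p] p m Suc.prems)
    have "coeff (q' e) i = 0" if "k \<le> i" for e i
    proof -
      have "coeff (m e * p e) i = coeff (q e) k * coeff (p e) (i - (k - d))"
        unfolding m_def using that False by (simp add: coeff_monom_mult)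
      moreover have "i - (k - d) = d \<or> Suc d \<le> i - (k - d)" "i - (k - d) = d \<longleftrightarrow> i = k"
        using that False by auto
      ultimately have "coeff (m e * p e) i = (if i = k then coeff (q e) k * coeff (p e) d else 0)"
        using p by (auto simp: polynomial_family_def)
      moreover have "coeff (q e) i = 0" if "i \<noteq> k"
        using that \<open>k \<le> i\<close> Suc.prems by (auto simp: polynomial_family_def)
      ultimately show ?thesis unfolding q'_def by auto
    qed
    then have "polynomial_family C k q'" using q' by (auto simp: polynomial_family_def)
    from Suc.IH[OF this] obtain r where r: "polynomial_family C d r"
      and eq: "\<And>e. \<exists>s j. Polynomial.smult (coeff (p e) d ^ j) (q' e) = p e * s + r e" by blast
    have "\<exists>s j. Polynomial.smult (coeff (p e) d ^ j) (q e) = p e * s + r e" for e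
    proof -
      obtain s j where sj: "Polynomial.smult (coeff (p e) d ^ j) (q' e) = p e * s + r e"
        using eq by blast
      have "Polynomial.smult (coeff (p e) d ^ Suc j) (q e)
          = Polynomial.smult (coeff (p e) d ^ j) (q' e)
            + p e * Polynomial.smult (coeff (p e) d ^ j) (m e)"
        unfolding q'_def by (simp add: smult_diff_right mult.commute)
      also have "\<dots> = p e * (s + Polynomial.smult (coeff (p e) d ^ j) (m e)) + r e"
        unfolding sj by (simp add: algebra_simps)
      finally show ?thesis by blast
    qed
    then show ?thesis using r by blast
  qed
qed

text \<open>
  Constructible sets in the normal form that elimination produces: finite unions of sets cut out by
  finitely many equations and one inequation.
\<close>

inductive constructible :: "('a \<Rightarrow> complex) set \<Rightarrow> 'a set \<Rightarrow> bool" for C where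
  basic: "finite F \<Longrightarrow> F \<subseteq> polynomial_functions C \<Longrightarrow> g \<in> polynomial_functions C \<Longrightarrow>
    constructible C {e. (\<forall>f\<in>F. f e = 0) \<and> g e \<noteq> 0}"
| Un: "constructible C S \<Longrightarrow> constructible C T \<Longrightarrow> constructible C (S \<union> T)"

lemma constructible_nonzero:
  "g \<in> polynomial_functions C \<Longrightarrow> constructible C {e. g e \<noteq> 0}"
  using constructible.basic[of "{}" C g] by simp

lemma constructible_empty: "constructible C {}"
  using constructible_nonzero[OF polynomial_functions.const, of C 0] by simp

lemma constructible_Int_basic:
  assumes "constructible C S" "finite F" "F \<subseteq> polynomial_functions C" "g \<in> polynomial_functions C"
  shows "constructible C ({e. (\<forall>f\<in>F. f e = 0) \<and> g e \<noteq> 0} \<inter> S)"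
  using assms(1)
proof induction
  case (basic F' g')
  have "constructible C {e. (\<forall>f\<in>F \<union> F'. f e = 0) \<and> g e * g' e \<noteq> 0}"
    using assms basic by (intro constructible.basic polynomial_functions.mult) auto
  moreover have "{e. (\<forall>f\<in>F \<union> F'. f e = 0) \<and> g e * g' e \<noteq> 0} =
    {e. (\<forall>f\<in>F. f e = 0) \<and> g e \<noteq> 0} \<inter> {e. (\<forall>f\<in>F'. f e = 0) \<and> g' e \<noteq> 0}" by auto
  ultimately show ?case by simp
next
  case (Un S T)
  then show ?case by (simp add: Int_Un_distrib constructible.Un)
qed

lemma constructible_Int_zero:
  assumes "constructible C S" "c \<in> polynomial_functions C"
  shows "constructible C ({e. c e = 0} \<inter> S)"
  using constructible_Int_basic[OF assms(1), of "{c}" "\<lambda>_. 1"] assms(2)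
  by (simp add: polynomial_functions.const)

lemma constructible_Int_nonzero:
  assumes "constructible C S" "c \<in> polynomial_functions C"
  shows "constructible C ({e. c e \<noteq> 0} \<inter> S)"
  using constructible_Int_basic[OF assms(1), of "{}" c] assms(2) by simp

lemma constructible_family_nonzero:
  assumes "polynomial_family C d q"
  shows "constructible C {e. q e \<noteq> 0}"
proof -
  have "constructible C (\<Union>i<k. {e. coeff (q e) i \<noteq> 0})" for k
    by (induction k)
      (auto simp: lessThan_Suc intro!: constructible_empty constructible.Un constructible_nonzero
        polynomial_family_coeff[OF assms])
  moreover have "q e \<noteq> 0 \<longleftrightarrow> (\<exists>i<d. coeff (q e) i \<noteq> 0)" for e
  proof -
    have "i < d" if "coeff (q e) i \<noteq> 0" for i
      using assms that by (metis not_le polynomial_family_def)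
    then show ?thesis by (auto simp: poly_eq_iff)
  qed
  then have "{e. q e \<noteq> 0} = (\<Union>i<d. {e. coeff (q e) i \<noteq> 0})" by auto
  ultimately show ?thesis by simp
qed

lemma exists_root_nonroot_iff:
  fixes p q :: "complex poly"
  assumes "degree p \<le> d" "coeff p d \<noteq> 0"
  shows "(\<exists>t. poly p t = 0 \<and> poly q t \<noteq> 0) \<longleftrightarrow> \<not> p dvd q ^ d"
proof -
  have "degree p = d" using assms by (simp add: le_antisym le_degree)
  moreover have "p \<noteq> 0" using assms(2) by auto
  ultimately show ?thesis using nullstellensatz_univariate[of p q] by auto
qed

text \<open>
  By the univariate Nullstellensatz, \<open>p\<close> has a root outside the roots of \<open>q\<close> unless \<open>p\<close> divides
  \<open>q\<^sup>d\<close>, and divisibility means that the pseudo-remainder vanishes, a condition on its coefficients.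
\<close>

lemma constructible_exists_root:
  assumes "polynomial_family C (Suc d) p" "polynomial_family C k q"
  shows "constructible C
    ({e. coeff (p e) d \<noteq> 0} \<inter> {e. \<exists>t. poly (p e) t = 0 \<and> poly (q e) t \<noteq> 0})"
proof -
  obtain k' where "polynomial_family C k' (\<lambda>e. q e ^ d)"
    using polynomial_family_power[OF assms(2)] by blast
  from pseudo_division[OF assms(1) this] obtain r where r: "polynomial_family C d r"
    and eq: "\<And>e. \<exists>s j. Polynomial.smult (coeff (p e) d ^ j) (q e ^ d) = p e * s + r e" by blast
  have "(\<exists>t. poly (p e) t = 0 \<and> poly (q e) t \<noteq> 0) \<longleftrightarrow> r e \<noteq> 0" if c: "coeff (p e) d \<noteq> 0" for e
  proof -
    have deg: "degree (p e) = d"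
      using assms(1) c le_degree[OF c] by (auto simp: polynomial_family_def intro!: antisym degree_le)
    obtain s j where sj: "Polynomial.smult (coeff (p e) d ^ j) (q e ^ d) = p e * s + r e"
      using eq by blast
    have "p e dvd q e ^ d \<longleftrightarrow> p e dvd Polynomial.smult (coeff (p e) d ^ j) (q e ^ d)"
      using c by (simp add: dvd_smult_iff)
    also have "\<dots> \<longleftrightarrow> p e dvd r e" unfolding sj by (simp add: dvd_add_right_iff)
    also have "\<dots> \<longleftrightarrow> r e = 0"
    proof
      assume "p e dvd r e"
      moreover have "coeff (r e) i = 0" if "i \<ge> d" for i
        using r that by (auto simp: polynomial_family_def)
      ultimately show "r e = 0"
        using deg dvd_imp_degree_le[of "p e" "r e"] by (metis leading_coeff_0_iff)
    qed auto
    finally show ?thesis using exists_root_nonroot_iff[of "p e" d "q e"] deg c by simp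
  qed
  then have "{e. coeff (p e) d \<noteq> 0} \<inter> {e. \<exists>t. poly (p e) t = 0 \<and> poly (q e) t \<noteq> 0}
      = {e. coeff (p e) d \<noteq> 0} \<inter> {e. r e \<noteq> 0}" by auto
  moreover have "constructible C ({e. coeff (p e) d \<noteq> 0} \<inter> {e. r e \<noteq> 0})"
    by (rule constructible_Int_nonzero[OF constructible_family_nonzero[OF r]
          polynomial_family_coeff[OF assms(1)]])
  ultimately show ?thesis by simp
qed

text \<open>
  The Euclidean algorithm, run uniformly in the parameter. Let \<open>p\<close> have the least degree bound among the
  equations. Where its top coefficient vanishes, that term can be dropped; elsewhere any further
  equation is replaced by its pseudo-remainder modulo \<open>p\<close>. Either way the sum of the bounds drops, where
  each bound counts one more than its value so that discarding zero polynomials is progress as well.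
\<close>

lemma constructible_exists_common_root:
  assumes "\<forall>(d, p)\<in>set ps. polynomial_family C d p" "polynomial_family C k q"
  shows "constructible C {e. \<exists>t. (\<forall>(d, p)\<in>set ps. poly (p e) t = 0) \<and> poly (q e) t \<noteq> 0}"
  using assms(1)
proof (induction "sum_list (map (\<lambda>x. Suc (fst x)) ps)" arbitrary: ps rule: less_induct)
  case less
  define Z where "Z ps = {e. \<exists>t. (\<forall>(d, p)\<in>set ps. poly (p e) t = 0) \<and> poly (q e) t \<noteq> 0}"
    for ps :: "(nat \<times> ('a \<Rightarrow> complex poly)) list"
  show ?case
  proof (cases "ps = []")
    case True
    have "(\<exists>t. poly (q e) t \<noteq> 0) \<longleftrightarrow> q e \<noteq> 0" for e
      using poly_all_0_iff_0[of "q e"] by auto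
    then show ?thesis using constructible_family_nonzero[OF assms(2)] True by simp
  next
    case False
    have "\<exists>x\<in>set ps. \<forall>y\<in>set ps. fst x \<le> fst y"
      using False ex_min_if_finite[of "fst ` set ps"] by (auto simp: not_less)
    then obtain d' p where dp: "(d', p) \<in> set ps" and min: "\<And>y. y \<in> set ps \<Longrightarrow> d' \<le> fst y"
      by (metis prod.collapse)
    obtain xs ys where ps: "ps = xs @ (d', p) # ys" using split_list[OF dp] by blast
    have p: "polynomial_family C d' p" using less.prems dp by auto
    show ?thesis
    proof (cases d')
      case 0
      have "p e = 0" for e using p 0 by (auto simp: polynomial_family_def poly_eq_iff)
      then have "Z ps = Z (xs @ ys)" unfolding Z_def ps by auto
      moreover have "constructible C (Z (xs @ ys))"
        unfolding Z_def using less.prems by (intro less.hyps) (auto simp: ps)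
      ultimately show ?thesis unfolding Z_def by simp
    next
      case (Suc d)
      define c where "c e = coeff (p e) d" for e
      have c: "c \<in> polynomial_functions C"
        unfolding c_def by (rule polynomial_family_coeff[OF p])
      define p' where "p' e = p e - monom (c e) d" for e
      have "polynomial_family C (max d' (Suc d)) p'"
        unfolding p'_def by (intro polynomial_family_diff polynomial_family_monom p c)
      moreover have "coeff (p' e) d = 0" for e unfolding p'_def c_def by simp
      ultimately have p': "polynomial_family C d p'"
        unfolding polynomial_family_def Suc by (metis max.idem not_less_eq_eq order_antisym_conv)
      have "constructible C (Z (xs @ (d, p') # ys))"
        unfolding Z_def using less.prems p' by (intro less.hyps) (auto simp: ps Suc)
      moreover have "{e. c e = 0} \<inter> Z ps = {e. c e = 0} \<inter> Z (xs @ (d, p') # ys)"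
        unfolding Z_def ps p'_def by auto
      ultimately have zero: "constructible C ({e. c e = 0} \<inter> Z ps)"
        using constructible_Int_zero[OF _ c] by simp
      have nonzero: "constructible C ({e. c e \<noteq> 0} \<inter> Z ps)"
      proof (cases "xs @ ys = []")
        case True
        then show ?thesis
          using constructible_exists_root[OF p[unfolded Suc] assms(2)]
          unfolding Z_def ps c_def by simp
      next
        case False
        then obtain y where "y \<in> set (xs @ ys)" using hd_in_set by blast
        then obtain us vs where "xs @ ys = us @ y # vs" by (metis split_list)
        moreover obtain l p2 where "y = (l, p2)" by (cases y)
        ultimately have us: "xs @ ys = us @ (l, p2) # vs" by simp
        have sets: "set ps = insert (Suc d, p) (set (us @ (l, p2) # vs))"
          unfolding us[symmetric] by (auto simp: ps Suc)
        have sum: "sum_list (map (\<lambda>x. Suc (fst x)) ps)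
          = Suc (Suc d) + sum_list (map (\<lambda>x. Suc (fst x)) (us @ (l, p2) # vs))"
          unfolding us[symmetric] by (simp add: ps Suc)
        have l: "Suc d \<le> l" using min[of "(l, p2)"] sets Suc by auto
        have p2: "polynomial_family C l p2" using less.prems sets by auto
        obtain r where r: "polynomial_family C d r"
          and eq: "\<And>e. \<exists>s j. Polynomial.smult (coeff (p e) d ^ j) (p2 e) = p e * s + r e"
          using pseudo_division[OF p[unfolded Suc] p2] by blast
        have "constructible C (Z ((Suc d, p) # us @ (d, r) # vs))"
          unfolding Z_def using less.prems p r l sum sets Suc by (intro less.hyps) auto
        moreover have "{e. c e \<noteq> 0} \<inter> Z ps = {e. c e \<noteq> 0} \<inter> Z ((Suc d, p) # us @ (d, r) # vs)"
        proof -
          have "poly (p2 e) t = 0 \<longleftrightarrow> poly (r e) t = 0" if "c e \<noteq> 0" "poly (p e) t = 0" for e t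
          proof -
            obtain s j where "Polynomial.smult (coeff (p e) d ^ j) (p2 e) = p e * s + r e"
              using eq by blast
            from arg_cong[OF this[symmetric], of "\<lambda>f. poly f t"] that show ?thesis by (simp add: c_def)
          qed
          then show ?thesis unfolding Z_def sets by auto
        qed
        ultimately show ?thesis using constructible_Int_nonzero[OF _ c] by simp
      qed
      have "Z ps = ({e. c e = 0} \<inter> Z ps) \<union> ({e. c e \<noteq> 0} \<inter> Z ps)" by auto
      then show ?thesis using constructible.Un[OF zero nonzero] unfolding Z_def by simp
    qed
  qed
qed

text \<open>
  The heart of Chevalley's theorem: the projection along one variable of a constructible set is
  constructible.
\<close>

lemma constructible_projection:
  assumes "constructible C S"
    and coords: "\<And>x. x \<in> C \<Longrightarrow>
      \<exists>d p. polynomial_family C d p \<and> (\<forall>e t. x (\<gamma> e t) = poly (p e) t)"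
  shows "constructible C {e. \<exists>t. \<gamma> e t \<in> S}"
  using assms(1)
proof induction
  case (basic F g)
  have lift: "\<exists>d p. polynomial_family C d p \<and> (\<forall>e t. f (\<gamma> e t) = poly (p e) t)"
    if "f \<in> polynomial_functions C" for f
    using polynomial_function_along_curves[OF that, of C UNIV \<gamma>] coords by auto
  obtain D P where P: "\<And>f. f \<in> polynomial_functions C \<Longrightarrow> polynomial_family C (D f) (P f)"
    "\<And>f e t. f \<in> polynomial_functions C \<Longrightarrow> f (\<gamma> e t) = poly (P f e) t"
    using lift by metis
  obtain fs where fs: "F = set fs" using basic(1) finite_list by blast
  have "constructible C {e. \<exists>t. (\<forall>(d, p)\<in>set (map (\<lambda>f. (D f, P f)) fs). poly (p e) t = 0)
      \<and> poly (P g e) t \<noteq> 0}"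
    using basic fs P(1) by (intro constructible_exists_common_root) auto
  moreover have "{e. \<exists>t. (\<forall>(d, p)\<in>set (map (\<lambda>f. (D f, P f)) fs). poly (p e) t = 0)
      \<and> poly (P g e) t \<noteq> 0} = {e. \<exists>t. \<gamma> e t \<in> {e. (\<forall>f\<in>F. f e = 0) \<and> g e \<noteq> 0}}"
    using basic(2,3) fs P(2) by (auto simp: subset_iff)
  ultimately show ?case by simp
next
  case (Un S T)
  have "{e. \<exists>t. \<gamma> e t \<in> S \<union> T} = {e. \<exists>t. \<gamma> e t \<in> S} \<union> {e. \<exists>t. \<gamma> e t \<in> T}" by auto
  then show ?case using constructible.Un Un.IH by metis
qed

section \<open>Constructible sets and generic points\<close>

lemma generic_if_nonvanishing:
  assumes "g \<in> polynomial_functions C" "p0 \<in> X" "g p0 \<noteq> 0"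
    and "\<And>p. p \<in> X \<Longrightarrow> g p \<noteq> 0 \<Longrightarrow> P p"
  shows "generic C X P"
proof -
  have "closedin (zariski C X) (zero_locus X {g})"
    using assms(1) by (auto simp: closedin_zariski)
  moreover have "{p \<in> X. \<not> P p} \<subseteq> zero_locus X {g}"
    using assms(4) by (auto simp: zero_locus_def)
  ultimately have "zariski C X closure_of {p \<in> X. \<not> P p} \<subseteq> zero_locus X {g}"
    by (intro closure_of_minimal)
  moreover have "zero_locus X {g} \<subset> X" using assms(2,3) by (auto simp: zero_locus_def)
  ultimately show ?thesis unfolding generic_def by blast
qed

abbreviation coordinates :: "(('v \<Rightarrow> complex) \<Rightarrow> complex) set" where
  "coordinates \<equiv> range (\<lambda>v e. e v)"

lemma constructible_elimination:
  assumes "finite V" "constructible coordinates S"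
  shows "constructible coordinates {e. \<exists>e'\<in>S. \<forall>x. x \<notin> V \<longrightarrow> e' x = e x}"
  using assms(1)
proof induction
  case empty
  have "{e. \<exists>e'\<in>S. \<forall>x. x \<notin> {} \<longrightarrow> e' x = e x} = S" by (auto simp flip: fun_eq_iff)
  then show ?case using assms(2) by simp
next
  case (insert v V)
  let ?T = "{e. \<exists>e'\<in>S. \<forall>x. x \<notin> V \<longrightarrow> e' x = e x}"
  have "constructible coordinates {e. \<exists>t. e(v := t) \<in> ?T}"
  proof (rule constructible_projection[OF insert.IH])
    fix x :: "('a \<Rightarrow> complex) \<Rightarrow> complex"
    assume x: "x \<in> coordinates"
    then obtain u where u: "x = (\<lambda>e. e u)" by auto
    show "\<exists>d p. polynomial_family coordinates d p \<and> (\<forall>e t. x (e(v := t)) = poly (p e) t)"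
    proof (cases "u = v")
      case True
      have "\<forall>e t. x (e(v := t)) = poly [:0, 1:] t" using True u by simp
      then show ?thesis using polynomial_family_variable by fast
    next
      case False
      have "\<forall>e t. x (e(v := t)) = poly [:x e:] t" using False u by simp
      then show ?thesis
        using polynomial_family_const[OF polynomial_functions.coord[OF x]] by fast
    qed
  qed
  moreover have "{e. \<exists>t. e(v := t) \<in> ?T} = {e. \<exists>e'\<in>S. \<forall>x. x \<notin> insert v V \<longrightarrow> e' x = e x}"
  proof (intro Collect_eqI iffI)
    fix e assume "\<exists>t. e(v := t) \<in> ?T"
    then obtain t e' where "e' \<in> S" "\<forall>x. x \<notin> V \<longrightarrow> e' x = (e(v := t)) x" by blast
    then show "\<exists>e'\<in>S. \<forall>x. x \<notin> insert v V \<longrightarrow> e' x = e x" by (intro bexI[of _ e']) auto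
  next
    fix e assume "\<exists>e'\<in>S. \<forall>x. x \<notin> insert v V \<longrightarrow> e' x = e x"
    then obtain e' where e': "e' \<in> S" "\<forall>x. x \<notin> insert v V \<longrightarrow> e' x = e x" by blast
    then have "\<forall>x. x \<notin> V \<longrightarrow> e' x = (e(v := e' v)) x" by auto
    then show "\<exists>t. e(v := t) \<in> ?T" using e'(1) by blast
  qed
  ultimately show ?case by simp
qed

lemma constructible_vimage:
  assumes "constructible C S" "\<And>x. x \<in> C \<Longrightarrow> (\<lambda>q. x (\<gamma> q)) \<in> polynomial_functions C'"
  shows "constructible C' {q. \<gamma> q \<in> S}"
  using assms(1)
proof induction
  case (basic F g)
  have "constructible C' {q. (\<forall>f\<in>(\<lambda>f q. f (\<gamma> q)) ` F. f q = 0) \<and> g (\<gamma> q) \<noteq> 0}"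
    using basic by (intro constructible.basic)
      (auto intro: polynomial_functions_compose[where \<gamma> = \<gamma>, OF _ assms(2)])
  then show ?case by simp
next
  case (Un S T)
  have "{q. \<gamma> q \<in> S \<union> T} = {q. \<gamma> q \<in> S} \<union> {q. \<gamma> q \<in> T}" by auto
  then show ?case using Un.IH by (simp add: constructible.Un)
qed

definition not_identically_zero :: "'a set \<Rightarrow> ('a \<Rightarrow> complex) \<Rightarrow> bool" where
  "not_identically_zero X g \<longleftrightarrow> (\<exists>p\<in>X. g p \<noteq> 0)"

text \<open>
  If the polynomial functions on \<open>X\<close> form an integral domain, a constructible set either contains a
  nonempty open set \<open>g \<noteq> 0\<close> or lies in a hypersurface \<open>g = 0\<close>. A basic set does the former if its
  equations hold everywhere on \<open>X\<close> and its inequation holds somewhere; for unions, multiply the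
  witnesses.
\<close>

lemma constructible_generic_dichotomy:
  assumes domain: "\<And>f g. f \<in> polynomial_functions C \<Longrightarrow> g \<in> polynomial_functions C \<Longrightarrow>
      not_identically_zero X f \<Longrightarrow> not_identically_zero X g \<Longrightarrow>
      not_identically_zero X (\<lambda>p. f p * g p)"
    and X: "X \<noteq> {}" and S: "constructible C S"
  shows "\<exists>g\<in>polynomial_functions C. not_identically_zero X g \<and>
    ((\<forall>p\<in>X. g p \<noteq> 0 \<longrightarrow> p \<in> S) \<or> (\<forall>p\<in>X. p \<in> S \<longrightarrow> g p = 0))"
  using S
proof induction
  case (basic F g)
  consider "not_identically_zero X g" "\<forall>f\<in>F. \<not> not_identically_zero X f"
    | "\<not> not_identically_zero X g"
    | f where "f \<in> F" "not_identically_zero X f" by blast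
  then show ?case
  proof cases
    case 1
    then show ?thesis using basic(3) by (intro bexI[of _ g]) (auto simp: not_identically_zero_def)
  next
    case 2
    then show ?thesis using X
      by (intro bexI[of _ "\<lambda>_. 1"])
        (auto simp: not_identically_zero_def polynomial_functions.const)
  next
    case 3
    then show ?thesis using basic(2) by (intro bexI[of _ f]) auto
  qed
next
  case (Un S T)
  then obtain g h where g: "g \<in> polynomial_functions C" "not_identically_zero X g"
      "(\<forall>p\<in>X. g p \<noteq> 0 \<longrightarrow> p \<in> S) \<or> (\<forall>p\<in>X. p \<in> S \<longrightarrow> g p = 0)"
    and h: "h \<in> polynomial_functions C" "not_identically_zero X h"
      "(\<forall>p\<in>X. h p \<noteq> 0 \<longrightarrow> p \<in> T) \<or> (\<forall>p\<in>X. p \<in> T \<longrightarrow> h p = 0)" by blast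
  have "(\<lambda>p. g p * h p) \<in> polynomial_functions C" "not_identically_zero X (\<lambda>p. g p * h p)"
    using domain g h by (auto intro: polynomial_functions.mult)
  then show ?case using g(3) h(3) by (intro bexI[of _ "\<lambda>p. g p * h p"]) auto
qed

section \<open>Polynomial families of matrices\<close>

definition polynomial_matrix ::
    "('a \<Rightarrow> complex) set \<Rightarrow> 'a set \<Rightarrow> nat \<Rightarrow> ('a \<Rightarrow> complex mat) \<Rightarrow> bool" where
  "polynomial_matrix C X n N \<longleftrightarrow> (\<forall>p\<in>X. N p \<in> carrier_mat n n) \<and>
     (\<forall>i<n. \<forall>j<n. \<exists>f\<in>polynomial_functions C. \<forall>p\<in>X. N p $$ (i, j) = f p)"

lemma polynomial_matrix_carrier:
  "polynomial_matrix C X n N \<Longrightarrow> p \<in> X \<Longrightarrow> N p \<in> carrier_mat n n"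
  by (simp add: polynomial_matrix_def)

lemma polynomial_matrix_entries:
  assumes "polynomial_matrix C X n N"
  obtains f where "\<And>i j. i < n \<Longrightarrow> j < n \<Longrightarrow> f i j \<in> polynomial_functions C"
    "\<And>i j p. i < n \<Longrightarrow> j < n \<Longrightarrow> p \<in> X \<Longrightarrow> N p $$ (i, j) = f i j p"
proof -
  have "\<forall>i j. \<exists>f. i < n \<longrightarrow> j < n \<longrightarrow> f \<in> polynomial_functions C \<and> (\<forall>p\<in>X. N p $$ (i, j) = f p)"
    using assms unfolding polynomial_matrix_def by blast
  then obtain f where "\<And>i j. i < n \<longrightarrow> j < n \<longrightarrow>
      f i j \<in> polynomial_functions C \<and> (\<forall>p\<in>X. N p $$ (i, j) = f i j p)" by metis
  then show ?thesis by (intro that[of f]) auto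
qed

lemma polynomial_matrix_const:
  "A \<in> carrier_mat n n \<Longrightarrow> polynomial_matrix C X n (\<lambda>_. A)"
  unfolding polynomial_matrix_def
  by (auto intro!: bexI[of _ "\<lambda>_. A $$ _"] polynomial_functions.const)

lemma polynomial_matrix_add:
  assumes M: "polynomial_matrix C X n M" and N: "polynomial_matrix C X n N"
  shows "polynomial_matrix C X n (\<lambda>p. M p + N p)"
proof -
  obtain f where f: "\<And>i j. i < n \<Longrightarrow> j < n \<Longrightarrow> f i j \<in> polynomial_functions C"
    "\<And>i j p. i < n \<Longrightarrow> j < n \<Longrightarrow> p \<in> X \<Longrightarrow> M p $$ (i, j) = f i j p"
    using polynomial_matrix_entries[OF M] by blast
  obtain g where g: "\<And>i j. i < n \<Longrightarrow> j < n \<Longrightarrow> g i j \<in> polynomial_functions C"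
    "\<And>i j p. i < n \<Longrightarrow> j < n \<Longrightarrow> p \<in> X \<Longrightarrow> N p $$ (i, j) = g i j p"
    using polynomial_matrix_entries[OF N] by blast
  have c: "M p \<in> carrier_mat n n" "N p \<in> carrier_mat n n" if "p \<in> X" for p
    using M N that by (auto simp: polynomial_matrix_def)
  show ?thesis
    unfolding polynomial_matrix_def
  proof (intro conjI allI impI ballI)
    fix i j assume ij: "i < n" "j < n"
    show "\<exists>h\<in>polynomial_functions C. \<forall>p\<in>X. (M p + N p) $$ (i, j) = h p"
      using ij f g c[THEN carrier_matD(1)] c[THEN carrier_matD(2)]
      by (intro bexI[of _ "\<lambda>p. f i j p + g i j p"] polynomial_functions.add) auto
  qed (rule add_carrier_mat[OF c(2)])
qed

lemma polynomial_matrix_mult: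
  assumes M: "polynomial_matrix C X n M" and N: "polynomial_matrix C X n N"
  shows "polynomial_matrix C X n (\<lambda>p. M p * N p)"
proof -
  obtain f where f: "\<And>i j. i < n \<Longrightarrow> j < n \<Longrightarrow> f i j \<in> polynomial_functions C"
    "\<And>i j p. i < n \<Longrightarrow> j < n \<Longrightarrow> p \<in> X \<Longrightarrow> M p $$ (i, j) = f i j p"
    using polynomial_matrix_entries[OF M] by blast
  obtain g where g: "\<And>i j. i < n \<Longrightarrow> j < n \<Longrightarrow> g i j \<in> polynomial_functions C"
    "\<And>i j p. i < n \<Longrightarrow> j < n \<Longrightarrow> p \<in> X \<Longrightarrow> N p $$ (i, j) = g i j p"
    using polynomial_matrix_entries[OF N] by blast
  have c: "M p \<in> carrier_mat n n" "N p \<in> carrier_mat n n" if "p \<in> X" for p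
    using M N that by (auto simp: polynomial_matrix_def)
  show ?thesis
    unfolding polynomial_matrix_def
  proof (intro conjI allI impI ballI)
    fix p assume "p \<in> X"
    then show "M p * N p \<in> carrier_mat n n" by (intro mult_carrier_mat[OF c])
  next
    fix i j assume ij: "i < n" "j < n"
    have "(M p * N p) $$ (i, j) = (\<Sum>k<n. f i k p * g k j p)" if "p \<in> X" for p
      using c[OF that] ij f(2)[OF _ _ that] g(2)[OF _ _ that]
      by (simp add: scalar_prod_def lessThan_atLeast0)
    moreover have "(\<lambda>p. \<Sum>k<n. f i k p * g k j p) \<in> polynomial_functions C"
      using ij f(1) g(1) by (intro polynomial_functions_sum polynomial_functions.mult) auto
    ultimately show "\<exists>h\<in>polynomial_functions C. \<forall>p\<in>X. (M p * N p) $$ (i, j) = h p"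
      by (intro bexI[of _ "\<lambda>p. \<Sum>k<n. f i k p * g k j p"]) simp_all
  qed
qed

lemma polynomial_matrix_smult:
  assumes "c \<in> polynomial_functions C" and N: "polynomial_matrix C X n N"
  shows "polynomial_matrix C X n (\<lambda>p. c p \<cdot>\<^sub>m N p)"
proof -
  obtain g where g: "\<And>i j. i < n \<Longrightarrow> j < n \<Longrightarrow> g i j \<in> polynomial_functions C"
    "\<And>i j p. i < n \<Longrightarrow> j < n \<Longrightarrow> p \<in> X \<Longrightarrow> N p $$ (i, j) = g i j p"
    using polynomial_matrix_entries[OF N] by blast
  have c: "N p \<in> carrier_mat n n" if "p \<in> X" for p
    using N that by (auto simp: polynomial_matrix_def)
  show ?thesis
    unfolding polynomial_matrix_def
  proof (intro conjI allI impI ballI)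
    fix i j assume ij: "i < n" "j < n"
    show "\<exists>h\<in>polynomial_functions C. \<forall>p\<in>X. (c p \<cdot>\<^sub>m N p) $$ (i, j) = h p"
      using ij g c[THEN carrier_matD(1)] c[THEN carrier_matD(2)] assms(1)
      by (intro bexI[of _ "\<lambda>p. c p * g i j p"] polynomial_functions.mult) auto
  qed (rule smult_carrier_mat[OF c])
qed

lemma polynomial_function_of_polynomial_matrix:
  assumes "g \<in> polynomial_functions (mat_coords n)" "polynomial_matrix C UNIV n N"
  shows "(\<lambda>p. g (N p)) \<in> polynomial_functions C"
  using assms(1)
proof (rule polynomial_functions_compose)
  fix x assume "x \<in> mat_coords n"
  then obtain i j where x: "x = (\<lambda>A. A $$ (i, j))" "i < n" "j < n"
    unfolding mat_coords_def by blast
  obtain f where f: "\<And>i j. i < n \<Longrightarrow> j < n \<Longrightarrow> f i j \<in> polynomial_functions C"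
    "\<And>i j p. i < n \<Longrightarrow> j < n \<Longrightarrow> p \<in> UNIV \<Longrightarrow> N p $$ (i, j) = f i j p"
    using polynomial_matrix_entries[OF assms(2)] by blast
  have "(\<lambda>p. x (N p)) = f i j" using x f(2) by auto
  then show "(\<lambda>p. x (N p)) \<in> polynomial_functions C" using f(1) x by simp
qed

section \<open>Images of dominant polynomial maps\<close>

text \<open>
  Restrict both functions to the line through a point where the first does not vanish and a point
  where the second does not vanish; univariate polynomials form a domain.
\<close>

lemma matrix_polynomials_domain:
  assumes f: "f \<in> polynomial_functions (mat_coords n)"
    and g: "g \<in> polynomial_functions (mat_coords n)"
    and "not_identically_zero (carrier_mat n n) f" "not_identically_zero (carrier_mat n n) g"
  shows "not_identically_zero (carrier_mat n n) (\<lambda>A. f A * g A)"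
proof -
  obtain A B where A: "A \<in> carrier_mat n n" "f A \<noteq> 0" and B: "B \<in> carrier_mat n n" "g B \<noteq> 0"
    using assms(3,4) unfolding not_identically_zero_def by blast
  define \<gamma> where "\<gamma> t = A + t \<cdot>\<^sub>m (B - A)" for t
  have \<gamma>: "polynomial_matrix {\<lambda>t. t} UNIV n \<gamma>"
    unfolding \<gamma>_def using A B
    by (intro polynomial_matrix_add polynomial_matrix_smult polynomial_matrix_const
        polynomial_functions.coord) auto
  have ends: "\<gamma> 0 = A" "\<gamma> 1 = B" unfolding \<gamma>_def using A B by (auto intro!: eq_matI)
  obtain p q where p: "(\<lambda>t. f (\<gamma> t)) = poly p" and q: "(\<lambda>t. g (\<gamma> t)) = poly q"
    using polynomial_function_of_polynomial_matrix[OF f \<gamma>]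
      polynomial_function_of_polynomial_matrix[OF g \<gamma>] polynomial_functions_one_variable by metis
  have "poly p 0 \<noteq> 0" "poly q 1 \<noteq> 0"
    using fun_cong[OF p, of 0] fun_cong[OF q, of 1] ends A B by auto
  then have "p * q \<noteq> 0" by auto
  then obtain t where "poly (p * q) t \<noteq> 0" using poly_all_0_iff_0 by blast
  then have "f (\<gamma> t) * g (\<gamma> t) \<noteq> 0" using fun_cong[OF p, of t] fun_cong[OF q, of t] by simp
  moreover have "\<gamma> t \<in> carrier_mat n n" using polynomial_matrix_carrier[OF \<gamma>] by simp
  ultimately show ?thesis unfolding not_identically_zero_def by blast
qed

text \<open>
  The image of a polynomial map is constructible, as a projection of the graph. A map is dominant if no
  nontrivial polynomial vanishes on its image, and then the dichotomy leaves only one possibility: the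
  image contains a nonempty open set. The graph lives on variables of two kinds: \<open>Inl (i, j)\<close> for the
  entries of the matrix, and \<open>Inr v\<close> for the arguments of the map, of which only those in the finite set
  \<open>V\<close> matter and are eliminated.
\<close>

lemma dominant_image_contains_open:
  fixes f :: "('v \<Rightarrow> complex) \<Rightarrow> complex mat"
  assumes V: "finite V" and dep: "\<And>e e'. (\<And>v. v \<in> V \<Longrightarrow> e v = e' v) \<Longrightarrow> f e = f e'"
    and f: "polynomial_matrix coordinates UNIV n f"
    and dominant: "\<And>g. g \<in> polynomial_functions (mat_coords n) \<Longrightarrow> (\<And>e. g (f e) = 0) \<Longrightarrow>
      \<not> not_identically_zero (carrier_mat n n) g"
  shows "\<exists>g\<in>polynomial_functions (mat_coords n). not_identically_zero (carrier_mat n n) g \<and>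
    (\<forall>A\<in>carrier_mat n n. g A \<noteq> 0 \<longrightarrow> (\<exists>e. A = f e))"
proof -
  define graph where "graph =
    {e :: nat \<times> nat + 'v \<Rightarrow> complex. \<forall>i<n. \<forall>j<n. e (Inl (i, j)) = f (\<lambda>v. e (Inr v)) $$ (i, j)}"
  define \<iota> :: "complex mat \<Rightarrow> nat \<times> nat + 'v \<Rightarrow> complex" where "\<iota> A =
      (\<lambda>x. case x of Inl (i, j) \<Rightarrow> if i < n \<and> j < n then A $$ (i, j) else 0 | Inr v \<Rightarrow> 0)" for A
  obtain F where F: "\<And>i j. i < n \<Longrightarrow> j < n \<Longrightarrow> F i j \<in> polynomial_functions coordinates"
    "\<And>i j e. i < n \<Longrightarrow> j < n \<Longrightarrow> f e $$ (i, j) = F i j e"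
    using polynomial_matrix_entries[OF f] by auto
  have fc: "f e \<in> carrier_mat n n" for e using polynomial_matrix_carrier[OF f] by simp
  let ?eqs = "(\<lambda>(i, j) e. e (Inl (i, j)) - F i j (\<lambda>v. e (Inr v))) ` ({..<n} \<times> {..<n})"
  have "(\<lambda>e. e (Inl (i, j)) - F i j (\<lambda>v. e (Inr v))) \<in> polynomial_functions coordinates"
    if "i < n" "j < n" for i j
    by (intro polynomial_functions_diff polynomial_functions_compose[OF F(1)[OF that]])
      (auto intro: polynomial_functions.coord)
  then have "constructible coordinates {e. (\<forall>h\<in>?eqs. h e = 0) \<and> (1::complex) \<noteq> 0}"
    by (intro constructible.basic) (auto intro: polynomial_functions.const)
  moreover have "{e. (\<forall>h\<in>?eqs. h e = 0) \<and> (1::complex) \<noteq> 0} = graph"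
    unfolding graph_def using F(2) by auto
  ultimately have "constructible coordinates graph" by simp
  from constructible_elimination[OF finite_imageI[OF V, of Inr] this]
  have "constructible coordinates {e. \<exists>e'\<in>graph. \<forall>x. x \<notin> Inr ` V \<longrightarrow> e' x = e x}" .
  then have "constructible (mat_coords n)
      {A. \<iota> A \<in> {e. \<exists>e'\<in>graph. \<forall>x. x \<notin> Inr ` V \<longrightarrow> e' x = e x}}"
  proof (rule constructible_vimage)
    fix x :: "(nat \<times> nat + 'v \<Rightarrow> complex) \<Rightarrow> complex"
    assume "x \<in> coordinates"
    then obtain u where x: "x = (\<lambda>e. e u)" by auto
    show "(\<lambda>A. x (\<iota> A)) \<in> polynomial_functions (mat_coords n)"
    proof (cases u)
      case (Inl ij)
      obtain i j where ij: "ij = (i, j)" by (cases ij)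
      show ?thesis
      proof (cases "i < n \<and> j < n")
        case True
        then have "(\<lambda>A. A $$ (i, j)) \<in> mat_coords n" by (auto simp: mat_coords_def)
        then show ?thesis
          using True polynomial_functions.coord by (simp add: x Inl ij \<iota>_def)
      next
        case False
        then show ?thesis by (auto simp: x Inl ij \<iota>_def intro: polynomial_functions.const)
      qed
    next
      case (Inr v)
      then show ?thesis by (simp add: x \<iota>_def polynomial_functions.const)
    qed
  qed
  moreover have "(carrier_mat n n :: complex mat set) \<noteq> {}" using zero_carrier_mat by blast
  ultimately have "\<exists>g\<in>polynomial_functions (mat_coords n). not_identically_zero (carrier_mat n n) g \<and>
    ((\<forall>A\<in>carrier_mat n n. g A \<noteq> 0 \<longrightarrow>
        A \<in> {A. \<iota> A \<in> {e. \<exists>e'\<in>graph. \<forall>x. x \<notin> Inr ` V \<longrightarrow> e' x = e x}}) \<or>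
     (\<forall>A\<in>carrier_mat n n.
        A \<in> {A. \<iota> A \<in> {e. \<exists>e'\<in>graph. \<forall>x. x \<notin> Inr ` V \<longrightarrow> e' x = e x}} \<longrightarrow> g A = 0))"
    by (intro constructible_generic_dichotomy[OF matrix_polynomials_domain])
  then obtain g where g: "g \<in> polynomial_functions (mat_coords n)"
      "not_identically_zero (carrier_mat n n) g"
    and dich: "(\<forall>A\<in>carrier_mat n n. g A \<noteq> 0 \<longrightarrow> (\<exists>e'\<in>graph. \<forall>x. x \<notin> Inr ` V \<longrightarrow> e' x = \<iota> A x)) \<or>
      (\<forall>A\<in>carrier_mat n n. (\<exists>e'\<in>graph. \<forall>x. x \<notin> Inr ` V \<longrightarrow> e' x = \<iota> A x) \<longrightarrow> g A = 0)"
    unfolding mem_Collect_eq by (elim bexE conjE) (rule that)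
  have image: "(\<exists>e'\<in>graph. \<forall>x. x \<notin> Inr ` V \<longrightarrow> e' x = \<iota> A x) \<longleftrightarrow> (\<exists>e. A = f e)"
    if A: "A \<in> carrier_mat n n" for A
  proof
    assume "\<exists>e'\<in>graph. \<forall>x. x \<notin> Inr ` V \<longrightarrow> e' x = \<iota> A x"
    then obtain e' where e': "e' \<in> graph" "\<And>x. x \<notin> Inr ` V \<Longrightarrow> e' x = \<iota> A x" by blast
    have "A $$ (i, j) = f (\<lambda>v. e' (Inr v)) $$ (i, j)" if "i < n" "j < n" for i j
      using e'(1) e'(2)[of "Inl (i, j)"] that by (simp add: graph_def \<iota>_def image_iff)
    then have "A = f (\<lambda>v. e' (Inr v))" using A fc[THEN carrier_matD(1)] fc[THEN carrier_matD(2)] by (intro eq_matI) auto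
    then show "\<exists>e. A = f e" by blast
  next
    assume "\<exists>e. A = f e"
    then obtain e where e: "A = f e" by blast
    define e' where "e' = (\<lambda>x. case x of Inl ij \<Rightarrow> \<iota> A x | Inr v \<Rightarrow> if v \<in> V then e v else 0)"
    have "f (\<lambda>v. e' (Inr v)) = f e" by (rule dep) (simp add: e'_def)
    then have "e' \<in> graph" unfolding graph_def e[symmetric] by (simp add: e'_def \<iota>_def)
    moreover have "e' x = \<iota> A x" if "x \<notin> Inr ` V" for x
      using that by (auto simp: e'_def \<iota>_def split: sum.split)
    ultimately show "\<exists>e'\<in>graph. \<forall>x. x \<notin> Inr ` V \<longrightarrow> e' x = \<iota> A x" by blast
  qed
  have "\<not> (\<forall>A\<in>carrier_mat n n. (\<exists>e. A = f e) \<longrightarrow> g A = 0)"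
    using dominant[OF g(1)] g(2) fc by blast
  then have "\<forall>A\<in>carrier_mat n n. g A \<noteq> 0 \<longrightarrow> (\<exists>e. A = f e)"
    using dich image by blast
  then show ?thesis using g by blast
qed

lemma poly_eq_sum_coeff:
  fixes p :: "complex poly"
  assumes "\<And>i. d \<le> i \<Longrightarrow> coeff p i = 0"
  shows "poly p t = (\<Sum>i<d. coeff p i * t ^ i)"
proof -
  have "poly p t = (\<Sum>i\<le>degree p. coeff p i * t ^ i)" by (rule poly_altdef)
  also have "\<dots> = (\<Sum>i<max d (Suc (degree p)). coeff p i * t ^ i)"
    by (rule sum.mono_neutral_left) (auto simp: coeff_eq_0)
  also have "\<dots> = (\<Sum>i<d. coeff p i * t ^ i)"
    by (rule sum.mono_neutral_right) (use assms in auto)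
  finally show ?thesis .
qed

text \<open>
  Expand \<open>g (Y + t Z) = (\<Sum>k. t\<^sup>k g\<^sub>k(Z))\<close>. If \<open>g\<^sub>k\<close> is the first nonzero term, then along the curve
  \<open>Y + t w(t)\<close> the quotient by \<open>t\<^sup>k\<close> of \<open>g\<close> tends to \<open>g\<^sub>k(w(0))\<close> as \<open>t \<rightarrow> 0\<close>. So if \<open>g\<close> vanishes on one curve
  in every direction \<open>w(0)\<close>, there is no such term. This yields dominance of any map with a surjective
  differential at some point.
\<close>

lemma polynomial_vanishing_along_all_directions:
  assumes g: "g \<in> polynomial_functions (mat_coords n)" and Y: "Y \<in> carrier_mat n n"
    and curves: "\<And>Z. Z \<in> carrier_mat n n \<Longrightarrow> \<exists>w. polynomial_matrix {\<lambda>t. t} UNIV n w \<and> w 0 = Z \<and>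
      (\<forall>t. g (Y + t \<cdot>\<^sub>m w t) = 0)"
    and A: "A \<in> carrier_mat n n"
  shows "g A = 0"
proof -
  have "\<exists>d p. polynomial_family (mat_coords n) d p \<and>
      (\<forall>Z\<in>carrier_mat n n. \<forall>t. g (Y + t \<cdot>\<^sub>m Z) = poly (p Z) t)"
    using g
  proof (rule polynomial_function_along_curves)
    fix x assume x: "x \<in> mat_coords n"
    then obtain i j where ij: "x = (\<lambda>A. A $$ (i, j))" "i < n" "j < n"
      unfolding mat_coords_def by blast
    have "polynomial_family (mat_coords n) (max 1 (1 + 2)) (\<lambda>Z. [:x Y:] + [:x Z:] * [:0, 1:])"
      by (intro polynomial_family_add polynomial_family_mult polynomial_family_const
          polynomial_family_variable polynomial_functions.const polynomial_functions.coord x)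
    moreover have "\<forall>Z\<in>carrier_mat n n. \<forall>t. x (Y + t \<cdot>\<^sub>m Z) = poly ([:x Y:] + [:x Z:] * [:0, 1:]) t"
      using Y ij by auto
    ultimately show "\<exists>d p. polynomial_family (mat_coords n) d p \<and>
        (\<forall>Z\<in>carrier_mat n n. \<forall>t. x (Y + t \<cdot>\<^sub>m Z) = poly (p Z) t)" by blast
  qed
  then obtain d p where p: "polynomial_family (mat_coords n) d p"
    and eq: "\<And>Z t. Z \<in> carrier_mat n n \<Longrightarrow> g (Y + t \<cdot>\<^sub>m Z) = poly (p Z) t" by blast
  have zero: "coeff (p Z) k = 0" if "Z \<in> carrier_mat n n" for Z k
    using that
  proof (induction k arbitrary: Z rule: less_induct)
    case (less k)
    obtain w where w: "polynomial_matrix {\<lambda>t. t} UNIV n w" "w 0 = Z"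
      "\<And>t. g (Y + t \<cdot>\<^sub>m w t) = 0" using curves[OF less.prems] by blast
    have wc: "w t \<in> carrier_mat n n" for t using polynomial_matrix_carrier[OF w(1)] by simp
    \<comment> \<open>\<open>h t = g (Y + t w(t)) / t\<^sup>k\<close> for \<open>t \<noteq> 0\<close>, and \<open>h 0\<close> is the term under consideration.\<close>
    define h where "h t = (\<Sum>i<Suc d. coeff (p (w t)) (k + i) * t ^ i)" for t
    have "(\<lambda>t. t ^ i) \<in> polynomial_functions {\<lambda>t. t}" for i :: nat
      using polynomial_functions_one_variable[of "\<lambda>t. t ^ i"]
      by (metis (no_types) poly_monom mult_1 ext)
    then have "h \<in> polynomial_functions {\<lambda>t. t}"
      unfolding h_def
      by (intro polynomial_functions_sum polynomial_functions.mult
          polynomial_function_of_polynomial_matrix[OF polynomial_family_coeff[OF p] w(1)])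
    moreover have "h t = 0" if "t \<noteq> 0" for t
    proof -
      have "coeff (p (w t)) i = 0" if "k + Suc d \<le> i" for i
        using p that by (auto simp: polynomial_family_def)
      then have "poly (p (w t)) t = (\<Sum>i<k + Suc d. coeff (p (w t)) i * t ^ i)"
        by (rule poly_eq_sum_coeff)
      also have "\<dots> = (\<Sum>i=k..<k + Suc d. coeff (p (w t)) i * t ^ i)"
        by (rule sum.mono_neutral_right) (use less.IH wc in auto)
      also have "\<dots> = (\<Sum>i<Suc d. coeff (p (w t)) (k + i) * t ^ (k + i))"
        using sum.shift_bounds_nat_ivl[of "\<lambda>i. coeff (p (w t)) i * t ^ i" 0 k "Suc d"]
        by (simp add: lessThan_atLeast0 add.commute)
      also have "\<dots> = t ^ k * h t"
        unfolding h_def sum_distrib_left by (intro sum.cong refl) (simp add: power_add)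
      finally show ?thesis using eq[OF wc] w(3) that by simp
    qed
    ultimately have "h 0 = 0" by (rule polynomial_function_eq_0_by_continuity)
    moreover have "h 0 = coeff (p Z) k"
      unfolding h_def w(2) by (subst sum.lessThan_Suc_shift) simp
    ultimately show ?case by simp
  qed
  have "Y + 1 \<cdot>\<^sub>m (A - Y) = A" using A Y by (intro eq_matI) auto
  moreover have "A - Y \<in> carrier_mat n n" using Y by (rule minus_carrier_mat)
  ultimately have "g A = poly (p (A - Y)) 1" using eq by metis
  also have "p (A - Y) = 0" using zero \<open>A - Y \<in> carrier_mat n n\<close> by (simp add: poly_eq_iff)
  finally show ?thesis by simp
qed

section \<open>Spanning families\<close>

definition matrix_subspace :: "nat \<Rightarrow> complex mat set \<Rightarrow> bool" where
  "matrix_subspace n I \<longleftrightarrow> I \<subseteq> carrier_mat n n \<and> 0\<^sub>m n n \<in> I \<and>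
     (\<forall>A\<in>I. \<forall>B\<in>I. A + B \<in> I) \<and> (\<forall>c. \<forall>A\<in>I. c \<cdot>\<^sub>m A \<in> I)"

text \<open>
  The elementary matrix of the \<open>k\<close>-th position, where positions are numbered row by row.
\<close>

definition matrix_unit :: "nat \<Rightarrow> nat \<Rightarrow> complex mat" where
  "matrix_unit n k = mat n n (\<lambda>(i, j). if k = i * n + j then 1 else 0)"

lemma matrix_index_bij:
  fixes n k :: nat
  assumes "k < n * n"
  shows "k div n < n" "k mod n < n"
  using assms by (auto simp: less_mult_imp_div_less intro!: mod_less_divisor gr0I)

lemma matrix_index_less:
  fixes i j n :: nat
  assumes "i < n" "j < n"
  shows "i * n + j < n * n"
proof -
  have "i * n + j < Suc i * n" using assms by simp
  also have "\<dots> \<le> n * n" using assms by (intro mult_le_mono1) simp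
  finally show ?thesis .
qed

text \<open>
  Being a spanning family is an open condition, witnessed by the \<open>n\<^sup>2 \<times> n\<^sup>2\<close> determinant whose columns are
  the flattened members of the family; at a point where these are the elementary matrices, the
  determinant is that of the identity.
\<close>

lemma spanning_near_matrix_units:
  assumes N: "\<And>k. k < n * n \<Longrightarrow> polynomial_matrix C X n (N k)"
    and p0: "p0 \<in> X" "\<And>k. k < n * n \<Longrightarrow> N k p0 = matrix_unit n k"
  shows "\<exists>g\<in>polynomial_functions C. g p0 \<noteq> 0 \<and>
    (\<forall>p\<in>X. g p \<noteq> 0 \<longrightarrow> (\<forall>I. matrix_subspace n I \<longrightarrow> (\<forall>k<n * n. N k p \<in> I) \<longrightarrow> carrier_mat n n \<subseteq> I))"
proof -
  let ?n2 = "n * n"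
  define M where "M p = mat ?n2 ?n2 (\<lambda>(l, k). N k p $$ (l div n, l mod n))" for p
  have M: "M p \<in> carrier_mat ?n2 ?n2" for p by (simp add: M_def)
  have "\<forall>l k. \<exists>f. l < ?n2 \<longrightarrow> k < ?n2 \<longrightarrow> f \<in> polynomial_functions C \<and> (\<forall>p\<in>X. M p $$ (l, k) = f p)"
  proof (intro allI)
    fix l k
    show "\<exists>f. l < ?n2 \<longrightarrow> k < ?n2 \<longrightarrow> f \<in> polynomial_functions C \<and> (\<forall>p\<in>X. M p $$ (l, k) = f p)"
    proof (cases "l < ?n2 \<and> k < ?n2")
      case True
      then have "\<exists>f\<in>polynomial_functions C. \<forall>p\<in>X. N k p $$ (l div n, l mod n) = f p"
        using N[of k] matrix_index_bij[of l n] unfolding polynomial_matrix_def by blast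
      then show ?thesis using True by (auto simp: M_def)
    qed auto
  qed
  then obtain f where f: "\<And>l k. l < ?n2 \<Longrightarrow> k < ?n2 \<Longrightarrow> f l k \<in> polynomial_functions C"
    "\<And>l k p. l < ?n2 \<Longrightarrow> k < ?n2 \<Longrightarrow> p \<in> X \<Longrightarrow> M p $$ (l, k) = f l k p" by metis
  define g where "g p = (\<Sum>\<pi>\<in>{\<pi>. \<pi> permutes {0..<?n2}}. signof \<pi> * (\<Prod>i=0..<?n2. f i (\<pi> i) p))" for p
  have perm: "\<pi> i < ?n2" if "\<pi> permutes {0..<?n2}" "i < ?n2" for \<pi> i
    using permutes_in_image[OF that(1), of i] that(2) by simp
  have g: "g \<in> polynomial_functions C"
    unfolding g_def
    by (intro polynomial_functions_sum polynomial_functions.mult polynomial_functions.const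
        polynomial_functions_prod f(1)) (auto intro: perm)
  have det: "det (M p) = g p" if "p \<in> X" for p
    unfolding g_def det_def'[OF M]
    by (intro sum.cong arg_cong2[of _ _ _ _ "(*)"] prod.cong refl f(2)[OF _ _ that]) (auto intro: perm)
  have "M p0 = 1\<^sub>m ?n2"
  proof (rule eq_matI)
    fix l k assume "l < dim_row (1\<^sub>m ?n2)" "k < dim_col (1\<^sub>m ?n2)"
    then show "M p0 $$ (l, k) = 1\<^sub>m ?n2 $$ (l, k)"
      using p0(2) matrix_index_bij[of l n] unfolding M_def
      by (auto simp: matrix_unit_def)
  qed (auto simp: M_def)
  then have "g p0 \<noteq> 0" using det[OF p0(1)] by simp
  moreover have "carrier_mat n n \<subseteq> I"
    if p: "p \<in> X" "g p \<noteq> 0" and I: "matrix_subspace n I" and NI: "\<forall>k<?n2. N k p \<in> I" for p I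
  proof
    fix A :: "complex mat" assume A: "A \<in> carrier_mat n n"
    from det_non_zero_imp_unit[OF M, of p] det[OF p(1)] p(2)
    obtain B where B: "B \<in> carrier_mat ?n2 ?n2" "M p * B = 1\<^sub>m ?n2"
      unfolding Units_def by (auto simp: ring_mat_simps)
    define a where "a = vec ?n2 (\<lambda>l. A $$ (l div n, l mod n))"
    define v where "v = B *\<^sub>v a"
    have Mv: "M p *\<^sub>v v = a"
      using B M[of p] assoc_mult_mat_vec[of "M p" ?n2 ?n2 B ?n2 a] by (simp add: v_def a_def)
    have "dim_vec v = ?n2" using B by (simp add: v_def)
    then have "(M p *\<^sub>v v) $ l = (\<Sum>k<?n2. v $ k * N k p $$ (l div n, l mod n))" if "l < ?n2" for l
      using that by (simp add: M_def scalar_prod_def lessThan_atLeast0 mult.commute)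
    then have entry: "(\<Sum>k<?n2. v $ k * N k p $$ (l div n, l mod n)) = A $$ (l div n, l mod n)"
      if "l < ?n2" for l
      using that unfolding Mv by (simp add: a_def)
    have Nc: "N k p \<in> carrier_mat n n" if "k < ?n2" for k
      using polynomial_matrix_carrier[OF N[OF that] p(1)] .
    have "mat n n (\<lambda>ij. \<Sum>k<K. v $ k * N k p $$ ij) \<in> I" if "K \<le> ?n2" for K
      using that
    proof (induction K)
      case 0
      have "mat n n (\<lambda>ij. \<Sum>k<0. v $ k * N k p $$ ij) = 0\<^sub>m n n" by (intro eq_matI) auto
      then show ?case using I by (simp add: matrix_subspace_def)
    next
      case (Suc K)
      have "mat n n (\<lambda>ij. \<Sum>k<Suc K. v $ k * N k p $$ ij) =
          mat n n (\<lambda>ij. \<Sum>k<K. v $ k * N k p $$ ij) + v $ K \<cdot>\<^sub>m N K p"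
        using Nc[of K] Suc.prems by (intro eq_matI) auto
      then show ?case using Suc I NI unfolding matrix_subspace_def by simp
    qed
    from this[of ?n2] have "mat n n (\<lambda>ij. \<Sum>k<?n2. v $ k * N k p $$ ij) \<in> I" by simp
    moreover have "mat n n (\<lambda>ij. \<Sum>k<?n2. v $ k * N k p $$ ij) = A"
    proof (rule eq_matI)
      fix i j assume "i < dim_row A" "j < dim_col A"
      then have ij: "i < n" "j < n" using A by auto
      then show "mat n n (\<lambda>ij. \<Sum>k<?n2. v $ k * N k p $$ ij) $$ (i, j) = A $$ (i, j)"
        using entry[OF matrix_index_less[OF ij]] by simp
    qed (use A in auto)
    ultimately show "A \<in> I" by simp
  qed
  ultimately show ?thesis using g by blast
qed

section \<open>Products of matrices and their differential\<close>

lemma polynomial_matrix_cong: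
  assumes "polynomial_matrix C X n M" "\<And>p. p \<in> X \<Longrightarrow> N p = M p"
  shows "polynomial_matrix C X n N"
  using assms by (simp add: polynomial_matrix_def)

lemma mat_prod_Nil [simp]: "mat_prod n [] = 1\<^sub>m n"
  by (simp add: mat_prod_def)

lemma mat_prod_Cons [simp]: "mat_prod n (T # Ts) = T * mat_prod n Ts"
  by (simp add: mat_prod_def)

lemma mat_prod_carrier: "set Ts \<subseteq> carrier_mat n n \<Longrightarrow> mat_prod n Ts \<in> carrier_mat n n"
  by (induction Ts) (auto intro!: mult_carrier_mat)

lemma mat_prod_append:
  assumes "set Ts \<subseteq> carrier_mat n n" "set Us \<subseteq> carrier_mat n n"
  shows "mat_prod n (Ts @ Us) = mat_prod n Ts * mat_prod n Us"
  using assms(1)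
proof (induction Ts)
  case Nil
  then show ?case using mat_prod_carrier[OF assms(2)] by simp
next
  case (Cons T Ts)
  have "T \<in> carrier_mat n n" "mat_prod n Ts \<in> carrier_mat n n" "mat_prod n Us \<in> carrier_mat n n"
    using Cons.prems mat_prod_carrier[of Ts n] mat_prod_carrier[OF assms(2)] by auto
  then show ?case using Cons by (simp add: assoc_mult_mat)
qed

lemma finsum_mat_insert:
  assumes "finite A" "a \<notin> A" "\<And>i. i \<in> insert a A \<Longrightarrow> f i \<in> carrier_mat n n"
  shows "(\<Oplus>\<^bsub>module_mat TYPE(complex) n n\<^esub>i\<in>insert a A. f i) =
    f a + (\<Oplus>\<^bsub>module_mat TYPE(complex) n n\<^esub>i\<in>A. f i)"
proof -
  interpret V: abelian_group "module_mat TYPE(complex) n n" by (rule abelian_group_mat)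
  show ?thesis
    using V.finsum_insert[OF assms(1,2), of f] assms(3) by (auto simp: module_mat_simps)
qed

lemma finsum_mat_empty: "(\<Oplus>\<^bsub>module_mat TYPE(complex) n n\<^esub>i\<in>{}. f i) = 0\<^sub>m n n"
proof -
  interpret V: abelian_group "module_mat TYPE(complex) n n" by (rule abelian_group_mat)
  show ?thesis by (simp add: module_mat_simps)
qed

lemma finsum_mat_closed:
  assumes "\<And>i. i \<in> A \<Longrightarrow> f i \<in> carrier_mat n n"
  shows "(\<Oplus>\<^bsub>module_mat TYPE(complex) n n\<^esub>i\<in>A. f i) \<in> carrier_mat n n"
proof -
  interpret V: abelian_group "module_mat TYPE(complex) n n" by (rule abelian_group_mat)
  show ?thesis using V.finsum_closed[of f A] assms by (auto simp: module_mat_simps)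
qed

lemma mult_finsum_mat:
  assumes "finite A" "T \<in> carrier_mat n n" "\<And>i. i \<in> A \<Longrightarrow> f i \<in> carrier_mat n n"
  shows "T * (\<Oplus>\<^bsub>module_mat TYPE(complex) n n\<^esub>i\<in>A. f i) =
    (\<Oplus>\<^bsub>module_mat TYPE(complex) n n\<^esub>i\<in>A. T * f i)"
  using assms(1,3)
proof induction
  case empty
  then show ?case using assms(2) by (simp add: finsum_mat_empty)
next
  case (insert a A)
  let ?S = "\<lambda>g B. \<Oplus>\<^bsub>module_mat TYPE(complex) n n\<^esub>i\<in>B. g i"
  have c: "?S f A \<in> carrier_mat n n" "f a \<in> carrier_mat n n"
    using insert.prems by (auto intro!: finsum_mat_closed)
  have "T * ?S f (insert a A) = T * (f a + ?S f A)"
    using insert by (subst finsum_mat_insert) auto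
  also have "\<dots> = T * f a + T * ?S f A"
    using assms(2) c by (intro mult_add_distrib_mat)
  also have "\<dots> = T * f a + ?S (\<lambda>i. T * f i) A" using insert by simp
  also have "\<dots> = ?S (\<lambda>i. T * f i) (insert a A)"
    using insert assms(2) by (subst finsum_mat_insert) (auto intro!: mult_carrier_mat)
  finally show ?case .
qed

lemma finsum_mat_cong:
  assumes "\<And>i. i \<in> A \<Longrightarrow> f i = g i" "\<And>i. i \<in> A \<Longrightarrow> g i \<in> carrier_mat n n"
  shows "(\<Oplus>\<^bsub>module_mat TYPE(complex) n n\<^esub>i\<in>A. f i) =
    (\<Oplus>\<^bsub>module_mat TYPE(complex) n n\<^esub>i\<in>A. g i)"
proof -
  interpret V: abelian_group "module_mat TYPE(complex) n n" by (rule abelian_group_mat)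
  show ?thesis
    by (rule V.finsum_cong') (use assms in \<open>auto simp: module_mat_simps\<close>)
qed

lemma mat_prod_differential_Nil: "mat_prod_differential n [] [] = 0\<^sub>m n n"
  by (simp add: mat_prod_differential_def finsum_mat_empty)

text \<open>
  Product rule for splitting off the first factor. It makes list induction available for the
  differential.
\<close>

lemma mat_prod_differential_Cons:
  assumes "length Xs = length Ts" "set (T # Ts) \<subseteq> carrier_mat n n" "set (X # Xs) \<subseteq> carrier_mat n n"
  shows "mat_prod_differential n (T # Ts) (X # Xs) =
    X * mat_prod n Ts + T * mat_prod_differential n Ts Xs"
proof -
  define r where "r = length Ts"
  define s where "s Us Ys k = mat_prod n (take k Us) * Ys ! k * mat_prod n (drop (k + 1) Us)"
    for Us Ys :: "complex mat list" and k
  have T: "T \<in> carrier_mat n n" and X: "X \<in> carrier_mat n n" using assms by auto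
  have c: "mat_prod n (take k Us) \<in> carrier_mat n n" "mat_prod n (drop k Us) \<in> carrier_mat n n"
    if "set Us \<subseteq> carrier_mat n n" for Us k
    using that set_take_subset[of k Us] set_drop_subset[of k Us] by (auto intro!: mat_prod_carrier)
  have Xk: "Xs ! k \<in> carrier_mat n n" if "k < r" for k
    using assms that by (auto simp: r_def)
  have cs: "s Ts Xs k \<in> carrier_mat n n" if "k < r" for k
  proof -
    have "set Ts \<subseteq> carrier_mat n n" using assms(2) by simp
    note c' = c(1)[OF this, of k] c(2)[OF this, of "k + 1"]
    show ?thesis
      unfolding s_def by (rule mult_carrier_mat[OF mult_carrier_mat[OF c'(1) Xk[OF that]] c'(2)])
  qed
  have head: "s (T # Ts) (X # Xs) 0 = X * mat_prod n Ts"
    unfolding s_def using X by simp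
  have tail: "s (T # Ts) (X # Xs) (Suc k) = T * s Ts Xs k" if "k < r" for k
  proof -
    have "set Ts \<subseteq> carrier_mat n n" using assms(2) by simp
    note c' = c[OF this, of k] c[OF this, of "Suc k"]
    show ?thesis
      unfolding s_def using T Xk[OF that] c' by (simp add: assoc_mult_mat[of _ n n _ n _ n] mult_carrier_mat[of _ n n _ n])
  qed
  have "mat_prod_differential n (T # Ts) (X # Xs) =
      (\<Oplus>\<^bsub>module_mat TYPE(complex) n n\<^esub>i\<in>insert (Suc r) {1..r}. s (T # Ts) (X # Xs) (Suc r - i))"
    unfolding mat_prod_differential_def s_def Let_def
    by (simp add: r_def atLeastAtMostSuc_conv)
  also have "\<dots> = X * mat_prod n Ts +
      (\<Oplus>\<^bsub>module_mat TYPE(complex) n n\<^esub>i\<in>{1..r}. s (T # Ts) (X # Xs) (Suc r - i))"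
  proof (subst finsum_mat_insert)
    fix i assume i: "i \<in> insert (Suc r) {1..r}"
    show "s (T # Ts) (X # Xs) (Suc r - i) \<in> carrier_mat n n"
    proof (cases "i = Suc r")
      case True
      then show ?thesis
        using head X mat_prod_carrier[of Ts n] assms(2) by (auto intro: mult_carrier_mat)
    next
      case False
      then have "Suc r - i = Suc (r - i)" "r - i < r" using i by auto
      then show ?thesis using tail cs T by (auto intro: mult_carrier_mat)
    qed
  qed (auto simp: head)
  also have "(\<Oplus>\<^bsub>module_mat TYPE(complex) n n\<^esub>i\<in>{1..r}. s (T # Ts) (X # Xs) (Suc r - i)) =
      (\<Oplus>\<^bsub>module_mat TYPE(complex) n n\<^esub>i\<in>{1..r}. T * s Ts Xs (r - i))"
  proof (rule finsum_mat_cong)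
    fix i assume "i \<in> {1..r}"
    then have "Suc r - i = Suc (r - i)" "r - i < r" by auto
    then show "s (T # Ts) (X # Xs) (Suc r - i) = T * s Ts Xs (r - i)"
      "T * s Ts Xs (r - i) \<in> carrier_mat n n"
      using tail cs T by (auto intro: mult_carrier_mat)
  qed
  also have "\<dots> = T * (\<Oplus>\<^bsub>module_mat TYPE(complex) n n\<^esub>i\<in>{1..r}. s Ts Xs (r - i))"
    by (rule mult_finsum_mat[symmetric]) (auto intro: T cs)
  also have "(\<Oplus>\<^bsub>module_mat TYPE(complex) n n\<^esub>i\<in>{1..r}. s Ts Xs (r - i)) =
      mat_prod_differential n Ts Xs"
    unfolding mat_prod_differential_def s_def Let_def r_def ..
  finally show ?thesis .
qed

lemma mat_prod_differential_carrier:
  assumes "length Xs = length Ts" "set Ts \<subseteq> carrier_mat n n" "set Xs \<subseteq> carrier_mat n n"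
  shows "mat_prod_differential n Ts Xs \<in> carrier_mat n n"
  using assms
proof (induction Xs Ts rule: list_induct2)
  case Nil
  then show ?case by (simp add: mat_prod_differential_Nil)
next
  case (Cons X Xs T Ts)
  then show ?case
    by (auto simp: mat_prod_differential_Cons intro!: add_carrier_mat mult_carrier_mat mat_prod_carrier)
qed

lemma mat_prod_differential_add:
  assumes "length Xs = length Ts" "length Ys = length Ts" "set Ts \<subseteq> carrier_mat n n"
    "set Xs \<subseteq> carrier_mat n n" "set Ys \<subseteq> carrier_mat n n"
  shows "mat_prod_differential n Ts (map2 (+) Xs Ys) =
    mat_prod_differential n Ts Xs + mat_prod_differential n Ts Ys"
  using assms
proof (induction Ts arbitrary: Xs Ys)
  case Nil
  then show ?case by (simp add: mat_prod_differential_Nil)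
next
  case (Cons T Ts)
  obtain X Xs' Y Ys' where XY: "Xs = X # Xs'" "Ys = Y # Ys'"
    using Cons.prems by (cases Xs; cases Ys) auto
  let ?L = "mat_prod_differential n Ts"
  have c: "T \<in> carrier_mat n n" "X \<in> carrier_mat n n" "Y \<in> carrier_mat n n"
    "mat_prod n Ts \<in> carrier_mat n n" "?L Xs' \<in> carrier_mat n n" "?L Ys' \<in> carrier_mat n n"
    using Cons.prems XY by (auto intro!: mat_prod_carrier mat_prod_differential_carrier)
  have len: "length (map2 (+) Xs' Ys') = length Ts" "set (map2 (+) Xs' Ys') \<subseteq> carrier_mat n n"
    using Cons.prems XY by (auto simp: set_zip intro!: add_carrier_mat)
  have "mat_prod_differential n (T # Ts) (map2 (+) Xs Ys) =
      (X + Y) * mat_prod n Ts + T * ?L (map2 (+) Xs' Ys')"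
    unfolding XY using Cons.prems XY len c by (simp add: mat_prod_differential_Cons)
  also have "?L (map2 (+) Xs' Ys') = ?L Xs' + ?L Ys'"
    using Cons.prems XY by (intro Cons.IH) auto
  also have "(X + Y) * mat_prod n Ts + T * (?L Xs' + ?L Ys') =
      (X * mat_prod n Ts + Y * mat_prod n Ts) + (T * ?L Xs' + T * ?L Ys')"
    using c by (simp add: add_mult_distrib_mat mult_add_distrib_mat)
  also have "\<dots> = (X * mat_prod n Ts + T * ?L Xs') + (Y * mat_prod n Ts + T * ?L Ys')"
    using c by (intro eq_matI) auto
  finally show ?case using Cons.prems XY by (simp add: mat_prod_differential_Cons)
qed

lemma mat_prod_differential_smult:
  assumes "length Xs = length Ts" "set Ts \<subseteq> carrier_mat n n" "set Xs \<subseteq> carrier_mat n n"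
  shows "mat_prod_differential n Ts (map ((\<cdot>\<^sub>m) c) Xs) = c \<cdot>\<^sub>m mat_prod_differential n Ts Xs"
  using assms
proof (induction Xs Ts rule: list_induct2)
  case Nil
  then show ?case by (simp add: mat_prod_differential_Nil smult_zero_mat)
next
  case (Cons X Xs T Ts)
  let ?L = "mat_prod_differential n Ts"
  have c: "T \<in> carrier_mat n n" "X \<in> carrier_mat n n"
    "mat_prod n Ts \<in> carrier_mat n n" "?L Xs \<in> carrier_mat n n"
    using Cons.prems Cons.hyps by (auto intro!: mat_prod_carrier mat_prod_differential_carrier)
  have "mat_prod_differential n (T # Ts) (map ((\<cdot>\<^sub>m) c) (X # Xs)) =
      (c \<cdot>\<^sub>m X) * mat_prod n Ts + T * (c \<cdot>\<^sub>m ?L Xs)"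
  proof -
    have "set (map ((\<cdot>\<^sub>m) c) (X # Xs)) \<subseteq> carrier_mat n n"
      using Cons.prems by (auto intro!: smult_carrier_mat)
    then show ?thesis using Cons by (simp add: mat_prod_differential_Cons)
  qed
  also have "\<dots> = c \<cdot>\<^sub>m (X * mat_prod n Ts) + c \<cdot>\<^sub>m (T * ?L Xs)"
    using c by (simp add: mult_smult_distrib mult_smult_assoc_mat)
  also have "\<dots> = c \<cdot>\<^sub>m (X * mat_prod n Ts + T * ?L Xs)"
    using c by (intro add_smult_distrib_left_mat[symmetric]) (auto intro: mult_carrier_mat)
  finally show ?case using Cons by (simp add: mat_prod_differential_Cons)
qed

lemma replicate_zero_carrier: "set (replicate k (0\<^sub>m n n)) \<subseteq> carrier_mat n n"
  by (auto simp: set_replicate_conv_if)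

lemma mat_prod_differential_zero:
  assumes "set Ts \<subseteq> carrier_mat n n"
  shows "mat_prod_differential n Ts (replicate (length Ts) (0\<^sub>m n n)) = 0\<^sub>m n n"
  using assms
proof (induction Ts)
  case Nil
  then show ?case by (simp add: mat_prod_differential_Nil)
next
  case (Cons T Ts)
  have "mat_prod n Ts \<in> carrier_mat n n" "T \<in> carrier_mat n n"
    using Cons.prems by (auto intro: mat_prod_carrier)
  then show ?case
    using Cons by (simp add: mat_prod_differential_Cons replicate_zero_carrier)
qed

lemma mat_prod_differential_single:
  assumes "set Ts \<subseteq> carrier_mat n n" "X \<in> carrier_mat n n" "j < length Ts"
  shows "mat_prod_differential n Ts ((replicate (length Ts) (0\<^sub>m n n))[j := X]) =
    mat_prod n (take j Ts) * X * mat_prod n (drop (Suc j) Ts)"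
  using assms(1,3)
proof (induction Ts arbitrary: j)
  case Nil
  then show ?case by simp
next
  case (Cons T Ts)
  have c: "T \<in> carrier_mat n n" "mat_prod n Ts \<in> carrier_mat n n"
    "mat_prod n (take k Ts) \<in> carrier_mat n n" "mat_prod n (drop k Ts) \<in> carrier_mat n n" for k
    using Cons.prems set_take_subset[of k Ts] set_drop_subset[of k Ts]
    by (auto intro!: mat_prod_carrier)
  show ?case
  proof (cases j)
    case 0
    then show ?thesis
      using Cons.prems assms(2) c
      by (simp add: mat_prod_differential_Cons mat_prod_differential_zero mult_carrier_mat
          replicate_zero_carrier right_mult_zero_mat)
  next
    case (Suc k)
    have sub: "set ((replicate (length Ts) (0\<^sub>m n n))[k := X]) \<subseteq> carrier_mat n n"
      using set_update_subset_insert[of "replicate (length Ts) (0\<^sub>m n n)" k X] assms(2) by auto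
    have k: "k < length Ts" using Cons.prems Suc by simp
    have "mat_prod_differential n (T # Ts) ((replicate (length (T # Ts)) (0\<^sub>m n n))[j := X]) =
        0\<^sub>m n n * mat_prod n Ts +
        T * (mat_prod n (take k Ts) * X * mat_prod n (drop (Suc k) Ts))"
      using Cons.prems sub k Cons.IH[of k] Suc by (simp add: mat_prod_differential_Cons)
    also have "\<dots> = T * mat_prod n (take k Ts) * X * mat_prod n (drop (Suc k) Ts)"
      using c(1,2) c(3)[of k] c(4)[of "Suc k"] assms(2) by (simp add: assoc_mult_mat[of _ n n _ n _ n] mult_carrier_mat[of _ n n _ n])
    finally show ?thesis using Suc by simp
  qed
qed

lemma polynomial_matrix_mat_prod:
  assumes "\<And>N. N \<in> set Ns \<Longrightarrow> polynomial_matrix C X n N"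
  shows "polynomial_matrix C X n (\<lambda>p. mat_prod n (map (\<lambda>N. N p) Ns))"
  using assms
  by (induction Ns) (auto intro: polynomial_matrix_const polynomial_matrix_mult)

lemma polynomial_matrix_differential:
  assumes "length Xs = length Ns" "\<And>N. N \<in> set Ns \<Longrightarrow> polynomial_matrix C X n N"
    "set Xs \<subseteq> carrier_mat n n"
  shows "polynomial_matrix C X n (\<lambda>p. mat_prod_differential n (map (\<lambda>N. N p) Ns) Xs)"
  using assms
proof (induction Xs Ns rule: list_induct2)
  case Nil
  then show ?case by (simp add: mat_prod_differential_Nil polynomial_matrix_const)
next
  case (Cons Y Xs N Ns)
  have "polynomial_matrix C X n (\<lambda>p. Y * mat_prod n (map (\<lambda>N. N p) Ns) +
      N p * mat_prod_differential n (map (\<lambda>N. N p) Ns) Xs)"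
    using Cons
    by (intro polynomial_matrix_add polynomial_matrix_mult polynomial_matrix_const
        polynomial_matrix_mat_prod) auto
  then show ?case
  proof (rule polynomial_matrix_cong)
    fix p assume p: "p \<in> X"
    have "set (map (\<lambda>N. N p) (N # Ns)) \<subseteq> carrier_mat n n"
      using polynomial_matrix_carrier[OF Cons.prems(1) p] by auto
    then show "mat_prod_differential n (map (\<lambda>N. N p) (N # Ns)) (Y # Xs) =
        Y * mat_prod n (map (\<lambda>N. N p) Ns) + N p * mat_prod_differential n (map (\<lambda>N. N p) Ns) Xs"
      using Cons.hyps Cons.prems(2) by (simp add: mat_prod_differential_Cons)
  qed
qed

text \<open>
  First-order expansion of the product along a line, with the differential as linear term and
  a remainder that is polynomial in \<open>t\<close>.
\<close>

lemma mat_prod_along_line: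
  assumes "length Xs = length Ts" "set Ts \<subseteq> carrier_mat n n" "set Xs \<subseteq> carrier_mat n n"
  shows "\<exists>w. polynomial_matrix {\<lambda>t. t} UNIV n w \<and> w 0 = mat_prod_differential n Ts Xs \<and>
    (\<forall>t. mat_prod n (map2 (\<lambda>T X. T + t \<cdot>\<^sub>m X) Ts Xs) = mat_prod n Ts + t \<cdot>\<^sub>m w t)"
  using assms
proof (induction Xs Ts rule: list_induct2)
  case Nil
  then show ?case
    by (intro exI[of _ "\<lambda>_. 0\<^sub>m n n"])
      (auto simp: mat_prod_differential_Nil smult_zero_mat intro: polynomial_matrix_const)
next
  case (Cons X Xs T Ts)
  then obtain w where w: "polynomial_matrix {\<lambda>t. t} UNIV n w"
      "w 0 = mat_prod_differential n Ts Xs"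
      "\<And>t. mat_prod n (map2 (\<lambda>T X. T + t \<cdot>\<^sub>m X) Ts Xs) = mat_prod n Ts + t \<cdot>\<^sub>m w t" by auto
  have wc: "w t \<in> carrier_mat n n" for t using polynomial_matrix_carrier[OF w(1)] by simp
  have c: "T \<in> carrier_mat n n" "X \<in> carrier_mat n n" "mat_prod n Ts \<in> carrier_mat n n"
    using Cons.prems by (auto intro!: mat_prod_carrier)
  define w' where "w' t = X * mat_prod n Ts + T * w t + t \<cdot>\<^sub>m (X * w t)" for t
  have "polynomial_matrix {\<lambda>t. t} UNIV n w'"
    unfolding w'_def using w(1) c
    by (intro polynomial_matrix_add polynomial_matrix_mult polynomial_matrix_smult
        polynomial_matrix_const polynomial_functions.coord) auto
  moreover have "w' 0 = mat_prod_differential n (T # Ts) (X # Xs)"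
    using Cons.prems Cons.hyps c wc[of 0] w(2)
    by (auto simp: mat_prod_differential_Cons w'_def intro!: eq_matI)
  moreover have "mat_prod n (map2 (\<lambda>T X. T + t \<cdot>\<^sub>m X) (T # Ts) (X # Xs)) =
      mat_prod n (T # Ts) + t \<cdot>\<^sub>m w' t" for t
  proof -
    have "mat_prod n (map2 (\<lambda>T X. T + t \<cdot>\<^sub>m X) (T # Ts) (X # Xs)) =
        (T + t \<cdot>\<^sub>m X) * (mat_prod n Ts + t \<cdot>\<^sub>m w t)" using w(3) by simp
    also have "\<dots> = T * mat_prod n Ts + t \<cdot>\<^sub>m (X * mat_prod n Ts) +
        t \<cdot>\<^sub>m (T * w t + t \<cdot>\<^sub>m (X * w t))"
      using c wc[of t]
      by (simp add: add_mult_distrib_mat[of _ n n] mult_add_distrib_mat[of _ n n]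
          mult_smult_distrib[of _ n n] mult_smult_assoc_mat[of _ n n])
    also have "\<dots> = T * mat_prod n Ts + t \<cdot>\<^sub>m w' t"
      unfolding w'_def using c wc[of t] by (intro eq_matI) (auto simp: algebra_simps)
    finally show ?thesis by simp
  qed
  ultimately show ?case by blast
qed

section \<open>Full rank means surjectivity\<close>

lemma dim_module_mat: "vectorspace.dim class_ring (module_mat TYPE(complex) n n) = n * n"
proof -
  let ?V = "module_vec TYPE(complex) (n * n)" and ?W = "module_mat TYPE(complex) n n"
  let ?T = "\<lambda>v. mat n n (\<lambda>(i, j). v $ (i * n + j)) :: complex mat"
  interpret V: vec_space "TYPE(complex)" "n * n" .
  have "?T \<in> LinearCombinations.module_hom class_ring ?V ?W"
    unfolding LinearCombinations.module_hom_def
    by (auto simp: module_mat_simps module_vec_simps matrix_index_less intro!: eq_matI)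
  then have lin: "linear_map class_ring ?V ?W ?T"
    unfolding linear_map_def mod_hom_def mod_hom_axioms_def
    using vec_vs[of "n * n"] matrix_vs[of n n] by (auto simp: vectorspace_def)
  have inj: "inj_on ?T (carrier ?V)"
  proof (rule inj_onI)
    fix v w :: "complex vec"
    assume vw: "v \<in> carrier ?V" "w \<in> carrier ?V" "?T v = ?T w"
    show "v = w"
    proof (rule eq_vecI)
      fix l assume "l < dim_vec w"
      then have l: "l < n * n" using vw(2) by (simp add: module_vec_simps)
      then have "?T v $$ (l div n, l mod n) = ?T w $$ (l div n, l mod n)" using vw(3) by simp
      then show "v $ l = w $ l" using matrix_index_bij[OF l] by simp
    qed (use vw in \<open>auto simp: module_vec_simps\<close>)
  qed
  have surj: "?T ` carrier ?V = carrier ?W"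
  proof (intro equalityI subsetI)
    fix A :: "complex mat" assume "A \<in> carrier ?W"
    then have A: "A \<in> carrier_mat n n" by (simp add: module_mat_simps)
    let ?v = "vec (n * n) (\<lambda>l. A $$ (l div n, l mod n))"
    have "?T ?v = A" using A by (intro eq_matI) (auto simp: matrix_index_less)
    then show "A \<in> ?T ` carrier ?V"
      by (intro image_eqI[of _ _ ?v]) (auto simp: module_vec_simps)
  qed (auto simp: module_mat_simps)
  show ?thesis
    using linear_map.dim_eq[OF lin V.fin_dim inj surj] V.dim_is_n by simp
qed

lemma rank_on_surjective:
  assumes "f ` D = carrier_mat n n"
  shows "rank_on n D f = n\<^sup>2"
proof -
  have "(module_mat TYPE(complex) n n)\<lparr>carrier := carrier_mat n n\<rparr> = module_mat TYPE(complex) n n"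
    by (simp add: module_mat_def)
  then show ?thesis unfolding rank_on_def assms by (simp add: dim_module_mat power2_eq_square)
qed

section \<open>Toeplitz matrices\<close>

definition toeplitz :: "nat \<Rightarrow> (int \<Rightarrow> complex) \<Rightarrow> complex mat" where
  "toeplitz n y = mat n n (\<lambda>(i, j). y (int j - int i))"

lemma toeplitz_carrier [simp]: "toeplitz n y \<in> carrier_mat n n"
  by (simp add: toeplitz_def)

lemma toeplitz_in_Toep: "toeplitz n y \<in> Toep n"
  by (simp add: Toep_def toeplitz_def)

lemma Toep_carrier: "A \<in> Toep n \<Longrightarrow> A \<in> carrier_mat n n"
  by (simp add: Toep_def)

lemma Toep_eq_toeplitz:
  assumes "A \<in> Toep n"
  shows "\<exists>y. A = toeplitz n y"
proof (intro exI eq_matI)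
  let ?y = "\<lambda>d. if 0 \<le> d then A $$ (0, nat d) else A $$ (nat (- d), 0)"
  show "dim_row A = dim_row (toeplitz n ?y)" "dim_col A = dim_col (toeplitz n ?y)"
    using assms by (auto simp: Toep_def toeplitz_def)
  fix i j assume "i < dim_row (toeplitz n ?y)" "j < dim_col (toeplitz n ?y)"
  then have ij: "i < n" "j < n" by (auto simp: toeplitz_def)
  have const: "A $$ (i, j) = A $$ (i', j')"
    if "i' < n" "j' < n" "int j - int i = int j' - int i'" for i' j'
    using assms ij that unfolding Toep_def by blast
  show "A $$ (i, j) = toeplitz n ?y $$ (i, j)"
  proof (cases "i \<le> j")
    case True
    then have "A $$ (i, j) = A $$ (0, j - i)" using ij by (intro const) auto
    then show ?thesis using ij True by (simp add: toeplitz_def nat_diff_distrib)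
  next
    case False
    then have "A $$ (i, j) = A $$ (i - j, 0)" using ij by (intro const) auto
    then show ?thesis using ij False by (simp add: toeplitz_def nat_diff_distrib)
  qed
qed

lemma Toep_zero: "0\<^sub>m n n \<in> Toep n"
  by (simp add: Toep_def)

lemma Toep_one: "1\<^sub>m n \<in> Toep n"
  by (auto simp: Toep_def)

lemma Toep_add:
  assumes "A \<in> Toep n" "B \<in> Toep n"
  shows "A + B \<in> Toep n"
proof -
  obtain y z where "A = toeplitz n y" "B = toeplitz n z" using Toep_eq_toeplitz assms by blast
  then have "A + B = toeplitz n (\<lambda>d. y d + z d)" by (auto simp: toeplitz_def)
  then show ?thesis using toeplitz_in_Toep by simp
qed

lemma Toep_smult:
  assumes "A \<in> Toep n"
  shows "c \<cdot>\<^sub>m A \<in> Toep n"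
proof -
  obtain y where "A = toeplitz n y" using Toep_eq_toeplitz assms by blast
  then have "c \<cdot>\<^sub>m A = toeplitz n (\<lambda>d. c * y d)" by (auto simp: toeplitz_def)
  then show ?thesis using toeplitz_in_Toep by simp
qed

text \<open>
  Toeplitz matrices are the kernel of the displacement operator, which sends a matrix \<open>A\<close> to the
  \<open>N \<times> N\<close> matrix of the differences \<open>A\<^sub>i\<^sub>+\<^sub>1\<^sub>,\<^sub>j\<^sub>+\<^sub>1 - A\<^sub>i\<^sub>,\<^sub>j\<close>.
\<close>

lemma Toep_if_shift_invariant:
  assumes "C \<in> carrier_mat (Suc N) (Suc N)"
    and shift: "\<And>i j. i < N \<Longrightarrow> j < N \<Longrightarrow> C $$ (Suc i, Suc j) = C $$ (i, j)"
  shows "C \<in> Toep (Suc N)"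
proof -
  have iter: "C $$ (i + q, j + q) = C $$ (i, j)" if "i + q < Suc N" "j + q < Suc N" for i j q
    using that
  proof (induction q)
    case (Suc q)
    then show ?case using shift[of "i + q" "j + q"] by simp
  qed simp
  have le: "C $$ (i, j) = C $$ (i', j')"
    if i': "i \<le> i'" "i' < Suc N" "j' < Suc N" "int j - int i = int j' - int i'" for i j i' j'
  proof -
    obtain q where q: "i' = i + q" using le_Suc_ex[OF i'(1)] by blast
    then have "j' = j + q" using i'(4) by linarith
    then show ?thesis using iter[of i q j] i'(2,3) q by simp
  qed
  show ?thesis unfolding Toep_def
  proof (intro CollectI conjI allI impI assms(1))
    fix i j i' j'
    assume "i < Suc N" "j < Suc N" "i' < Suc N" "j' < Suc N" "int j - int i = int j' - int i'"
    then show "C $$ (i, j) = C $$ (i', j')"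
      using le[of i i' j' j] le[of i' i j j'] by (cases "i \<le> i'") auto
  qed
qed

text \<open>
  The two sums over the inner index differ only at their ends, so the displacement of a product of two
  Toeplitz matrices is a sum of two rank-one matrices.
\<close>

lemma toeplitz_mult_displacement:
  assumes "i < N" "j < N"
  shows "(toeplitz (Suc N) y * toeplitz (Suc N) s) $$ (Suc i, Suc j) -
      (toeplitz (Suc N) y * toeplitz (Suc N) s) $$ (i, j) =
    y (- 1 - int i) * s (int j + 1) - y (int N - int i) * s (int j - int N)"
proof -
  have entry: "(toeplitz (Suc N) y * toeplitz (Suc N) s) $$ (k, l) =
      (\<Sum>q<Suc N. y (int q - int k) * s (int l - int q))" if "k < Suc N" "l < Suc N" for k l
    using that by (simp add: toeplitz_def scalar_prod_def lessThan_atLeast0)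
  have "(toeplitz (Suc N) y * toeplitz (Suc N) s) $$ (Suc i, Suc j) =
      y (- 1 - int i) * s (int j + 1) + (\<Sum>q<N. y (int q - int i) * s (int j - int q))"
    using assms by (subst entry, simp, simp, subst sum.lessThan_Suc_shift)
      (simp add: algebra_simps)
  moreover have "(toeplitz (Suc N) y * toeplitz (Suc N) s) $$ (i, j) =
      (\<Sum>q<N. y (int q - int i) * s (int j - int q)) + y (int N - int i) * s (int j - int N)"
    using assms by (subst entry) auto
  ultimately show ?thesis by simp
qed

text \<open>
  The standard basis vectors \<open>e\<^sub>0, \<dots>, e\<^sub>N\<^sub>-\<^sub>1\<close>, repeated cyclically and doubled on each round. The factor
  could be any \<open>c\<close> with \<open>c\<^sup>2 \<noteq> 1\<close>.
\<close>

definition weighted_unit :: "nat \<Rightarrow> nat \<Rightarrow> nat \<Rightarrow> complex" where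
  "weighted_unit N k j = (if j = k mod N then 2 ^ (k div N) else 0)"

lemma weighted_unit_shift: "0 < N \<Longrightarrow> weighted_unit N (k + N) j = 2 * weighted_unit N k j"
  by (simp add: weighted_unit_def)

text \<open>
  The positive and the negative diagonals of the \<open>i\<close>-th Toeplitz matrix of the chain encode the vectors
  \<open>w\<^sub>i\<close> and \<open>w\<^sub>m\<^sub>+\<^sub>i\<close>, where \<open>w\<^sub>k\<close> is \<open>weighted_unit N k\<close> and \<open>m = \<lfloor>(N + 1)/2\<rfloor>\<close>. Thus the \<open>m\<close>
  steps of the chain cover the steps \<open>w\<^sub>k \<rightarrow> w\<^sub>k\<^sub>+\<^sub>1\<close> for all \<open>k < 2 m\<close>, hence a full round, as \<open>N \<le> 2 m\<close>.
\<close>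

definition chain_symbol :: "nat \<Rightarrow> nat \<Rightarrow> int \<Rightarrow> complex" where
  "chain_symbol N i d =
     (if d > 0 then weighted_unit N i (nat (int N - d))
      else if d < 0 then - weighted_unit N (Suc N div 2 + i) (nat (- 1 - d)) else 0)"

lemma matrix_subspace_diff:
  assumes "matrix_subspace n W" "A \<in> W" "B \<in> W"
  shows "A - B \<in> W"
proof -
  have "A + (- 1) \<cdot>\<^sub>m B \<in> W" "A \<in> carrier_mat n n" "B \<in> carrier_mat n n"
    using assms unfolding matrix_subspace_def by blast+
  moreover from this have "A + (- 1) \<cdot>\<^sub>m B = A - B" by (intro eq_matI) auto
  ultimately show ?thesis by simp
qed

text \<open>
  With the columns in reverse order (column \<open>j\<close> stands for \<open>N - 1 - j\<close>), the displacement of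
  \<open>Y S' - S Y\<close> becomes the symmetric-looking expression
  \<open>a w\<^sub>k\<^sub>+\<^sub>1\<^sup>T + w\<^sub>k a\<^sup>T + b w\<^sub>m\<^sub>+\<^sub>k\<^sub>+\<^sub>1\<^sup>T + w\<^sub>m\<^sub>+\<^sub>k b\<^sup>T\<close>. The vectors \<open>a\<close> and \<open>b\<close> hold the negative and
  the positive diagonals of \<open>Y\<close> and are arbitrary.
\<close>

lemma commutator_chain_displacement:
  fixes a b :: "nat \<Rightarrow> complex"
  assumes "i < N" "j < N"
  defines "Y \<equiv> toeplitz (Suc N) (\<lambda>d. if d < 0 then a (nat (- 1 - d)) else
      if d > 0 then b (nat (int N - d)) else 0)"
    and "S \<equiv> \<lambda>k. toeplitz (Suc N) (chain_symbol N k)"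
    and "D \<equiv> \<lambda>B::complex mat. B $$ (Suc i, N - j) - B $$ (i, N - 1 - j)"
  shows "D (Y * S (Suc k) - S k * Y) =
    a i * weighted_unit N (Suc k) j + weighted_unit N k i * a j +
    b i * weighted_unit N (Suc (Suc N div 2 + k)) j + weighted_unit N (Suc N div 2 + k) i * b j"
proof -
  have j: "N - j = Suc (N - 1 - j)" "N - 1 - j < N" using assms(2) by auto
  have c: "Y \<in> carrier_mat (Suc N) (Suc N)" "S l \<in> carrier_mat (Suc N) (Suc N)" for l
    unfolding Y_def S_def by simp_all
  have "D (Y * S (Suc k) - S k * Y) = D (Y * S (Suc k)) - D (S k * Y)"
    unfolding D_def using assms(1,2) c(1) c(2)[of k] c(2)[of "Suc k"] by simp
  also have "D (Y * S (Suc k)) = a i * weighted_unit N (Suc k) j +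
      b i * weighted_unit N (Suc (Suc N div 2 + k)) j"
    unfolding D_def Y_def S_def j(1) toeplitz_mult_displacement[OF assms(1) j(2)]
    using assms(1,2) by (simp add: chain_symbol_def of_nat_diff nat_diff_distrib)
  also have "D (S k * Y) = - (weighted_unit N k i * a j + weighted_unit N (Suc N div 2 + k) i * b j)"
    unfolding D_def Y_def S_def j(1) toeplitz_mult_displacement[OF assms(1) j(2)]
    using assms(1,2) by (simp add: chain_symbol_def of_nat_diff nat_diff_distrib)
  finally show ?thesis by simp
qed


text \<open>
  Modulo displacements of \<open>W\<close>, the previous lemma reads \<open>x w\<^sub>k\<^sub>+\<^sub>1\<^sup>T \<equiv> - w\<^sub>k x\<^sup>T\<close> for every vector \<open>x\<close>. Applying
  this twice gives \<open>w\<^sub>l\<^sub>+\<^sub>1 w\<^sub>k\<^sub>+\<^sub>1\<^sup>T \<equiv> w\<^sub>l w\<^sub>k\<^sup>T\<close>. After a full round of \<open>N\<close> steps the left-hand side has become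
  \<open>4 w\<^sub>l w\<^sub>k\<^sup>T\<close>, so \<open>w\<^sub>l w\<^sub>k\<^sup>T \<equiv> 0\<close>. These matrices span, hence every displacement is attained in \<open>W\<close>, and two
  matrices with the same displacement differ by a Toeplitz matrix.
\<close>

lemma toeplitz_commutators_generate:
  assumes W: "matrix_subspace (Suc N) W" and Toep: "Toep (Suc N) \<subseteq> W"
    and comm: "\<And>Y k. Y \<in> Toep (Suc N) \<Longrightarrow> k < Suc N div 2 \<Longrightarrow>
      Y * toeplitz (Suc N) (chain_symbol N (Suc k)) - toeplitz (Suc N) (chain_symbol N k) * Y \<in> W"
  shows "carrier_mat (Suc N) (Suc N) \<subseteq> W"
proof
  let ?w = "weighted_unit N" and ?m = "Suc N div 2"
  \<comment> \<open>\<open>K f\<close>: the matrix \<open>f\<close> is the displacement, with reversed columns, of an element of \<open>W\<close>.\<close>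
  define K where "K f \<longleftrightarrow>
    (\<exists>B\<in>W. \<forall>i<N. \<forall>j<N. B $$ (Suc i, N - j) - B $$ (i, N - 1 - j) = f i j)"
    for f :: "nat \<Rightarrow> nat \<Rightarrow> complex"
  have Wc: "B \<in> W \<Longrightarrow> B \<in> carrier_mat (Suc N) (Suc N)" for B
    using W unfolding matrix_subspace_def by blast
  have K_cong: "K g" if "K f" "\<And>i j. i < N \<Longrightarrow> j < N \<Longrightarrow> f i j = g i j" for f g
    using that unfolding K_def by simp
  have K_add: "K (\<lambda>i j. f i j + g i j)" if fg: "K f" "K g" for f g
  proof -
    obtain B C where B: "B \<in> W" "\<And>i j. i < N \<Longrightarrow> j < N \<Longrightarrow> B $$ (Suc i, N - j) - B $$ (i, N - 1 - j) = f i j"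
      and C: "C \<in> W" "\<And>i j. i < N \<Longrightarrow> j < N \<Longrightarrow> C $$ (Suc i, N - j) - C $$ (i, N - 1 - j) = g i j"
      using fg unfolding K_def by blast
    have "(B + C) $$ (Suc i, N - j) - (B + C) $$ (i, N - 1 - j) = f i j + g i j"
      if "i < N" "j < N" for i j
      using that B(2)[OF that, symmetric] C(2)[OF that, symmetric] Wc[OF B(1)] Wc[OF C(1)] by simp
    moreover have "B + C \<in> W" using W B(1) C(1) unfolding matrix_subspace_def by blast
    ultimately show ?thesis unfolding K_def by blast
  qed
  have K_smult: "K (\<lambda>i j. c * f i j)" if f: "K f" for c f
  proof -
    obtain B where B: "B \<in> W" "\<And>i j. i < N \<Longrightarrow> j < N \<Longrightarrow> B $$ (Suc i, N - j) - B $$ (i, N - 1 - j) = f i j"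
      using f unfolding K_def by blast
    have "(c \<cdot>\<^sub>m B) $$ (Suc i, N - j) - (c \<cdot>\<^sub>m B) $$ (i, N - 1 - j) = c * f i j"
      if "i < N" "j < N" for i j
      using that B(2)[OF that, symmetric] Wc[OF B(1)] by (simp add: right_diff_distrib)
    moreover have "c \<cdot>\<^sub>m B \<in> W" using W B(1) unfolding matrix_subspace_def by blast
    ultimately show ?thesis unfolding K_def by blast
  qed
  have K_diff: "K (\<lambda>i j. f i j - g i j)" if "K f" "K g" for f g
    using K_add[OF that(1) K_smult[OF that(2), of "- 1"]] by simp
  have K_zero: "K (\<lambda>_ _. 0)"
    unfolding K_def using W by (intro bexI[of _ "0\<^sub>m (Suc N) (Suc N)"]) (auto simp: matrix_subspace_def)
  have K_sum: "K (\<lambda>i j. \<Sum>p\<in>P. f p i j)" if "\<And>p. p \<in> P \<Longrightarrow> K (f p)" for P :: "(nat \<times> nat) set" and f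
    using that
  proof (induction P rule: infinite_finite_induct)
    case (insert p P)
    then show ?case using K_add[of "f p" "\<lambda>i j. \<Sum>p\<in>P. f p i j"] by simp
  qed (auto intro: K_zero)
  have base: "K (\<lambda>i j. x i * ?w (Suc k) j + ?w k i * x j)" if k: "k < ?m + ?m" for x k
  proof (cases "k < ?m")
    case True
    show ?thesis
      unfolding K_def
      using commutator_chain_displacement[of _ N _ x "\<lambda>_. 0" k]
      by (intro bexI[OF _ comm[OF toeplitz_in_Toep True]]) auto
  next
    case False
    then have k': "k - ?m < ?m" "?m + (k - ?m) = k" using k by auto
    show ?thesis
      unfolding K_def
      using commutator_chain_displacement[of _ N _ "\<lambda>_. 0" x "k - ?m"] k'(2)
      by (intro bexI[OF _ comm[OF toeplitz_in_Toep k'(1)]]) auto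
  qed
  have all: "K f" for f
  proof (cases "N = 0")
    case True
    then show ?thesis using K_cong[OF K_zero] by simp
  next
    case False
    then have N: "0 < N" by simp
    \<comment> \<open>Doubling \<open>w\<close> after a full round extends the relation to all indices.\<close>
    have step: "K (\<lambda>i j. x i * ?w (Suc k) j + ?w k i * x j)" for x k
    proof (induction k rule: less_induct)
      case (less k)
      show ?case
      proof (cases "k < N")
        case True
        then show ?thesis by (intro base) auto
      next
        case False
        then obtain k' where k': "k = k' + N" using le_Suc_ex[of N k] by (auto simp: add.commute)
        have "K (\<lambda>i j. 2 * (x i * ?w (Suc k') j + ?w k' i * x j))"
          using less.IH[of k'] N k' by (intro K_smult) simp
        then show ?thesis
          by (rule K_cong) (use N weighted_unit_shift[OF N, of "Suc k'"] weighted_unit_shift[OF N, of k'] k'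
            in \<open>simp add: algebra_simps\<close>)
      qed
    qed
    have diag: "K (\<lambda>i j. ?w (l + q) i * ?w (k + q) j - ?w l i * ?w k j)" for l k q
    proof (induction q)
      case 0
      then show ?case using K_zero by simp
    next
      case (Suc q)
      have "K (\<lambda>i j. (?w (Suc (l + q)) i * ?w (Suc (k + q)) j + ?w (k + q) i * ?w (Suc (l + q)) j) -
          (?w (k + q) i * ?w (Suc (l + q)) j + ?w (l + q) i * ?w (k + q) j) +
          (?w (l + q) i * ?w (k + q) j - ?w l i * ?w k j))"
        by (intro K_add K_diff step Suc)
      then show ?case by (rule K_cong) simp
    qed
    have unit: "K (\<lambda>i j. ?w l i * ?w k j)" for l k
    proof -
      have "K (\<lambda>i j. (1/3) * (?w (l + N) i * ?w (k + N) j - ?w l i * ?w k j))"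
        by (intro K_smult diag)
      then show ?thesis by (rule K_cong) (simp add: weighted_unit_shift[OF N])
    qed
    have "K (\<lambda>i j. \<Sum>(l, k)\<in>{..<N} \<times> {..<N}. f l k * (?w l i * ?w k j))"
      by (rule K_cong[OF K_sum[of "{..<N} \<times> {..<N}" "\<lambda>(l, k) i j. f l k * (?w l i * ?w k j)"]])
        (auto intro!: K_smult unit sum.cong)
    then show ?thesis
    proof (rule K_cong)
      fix i j assume ij: "i < N" "j < N"
      have "(\<Sum>(l, k)\<in>{..<N} \<times> {..<N}. f l k * (?w l i * ?w k j)) =
          (\<Sum>l<N. \<Sum>k<N. if k = j then if l = i then f l k else 0 else 0)"
        unfolding sum.cartesian_product[symmetric]
        by (intro sum.cong refl) (auto simp: weighted_unit_def)
      also have "\<dots> = f i j" using ij by simp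
      finally show "(\<Sum>(l, k)\<in>{..<N} \<times> {..<N}. f l k * (?w l i * ?w k j)) = f i j" .
    qed
  qed
  fix A :: "complex mat" assume A: "A \<in> carrier_mat (Suc N) (Suc N)"
  obtain B where B: "B \<in> W" and disp: "\<And>i j. i < N \<Longrightarrow> j < N \<Longrightarrow>
      B $$ (Suc i, N - j) - B $$ (i, N - 1 - j) = A $$ (Suc i, N - j) - A $$ (i, N - 1 - j)"
    using all[of "\<lambda>i j. A $$ (Suc i, N - j) - A $$ (i, N - 1 - j)"] unfolding K_def by blast
  have "A - B \<in> Toep (Suc N)"
  proof (rule Toep_if_shift_invariant)
    fix i j assume ij: "i < N" "j < N"
    then have "N - (N - 1 - j) = Suc j" "N - 1 - (N - 1 - j) = j" "N - 1 - j < N" by auto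
    then have "B $$ (Suc i, Suc j) - B $$ (i, j) = A $$ (Suc i, Suc j) - A $$ (i, j)"
      using disp[OF ij(1), of "N - 1 - j"] by simp
    then show "(A - B) $$ (Suc i, Suc j) = (A - B) $$ (i, j)"
      using ij A Wc[OF B] by (simp add: algebra_simps)
  qed (use Wc[OF B] in \<open>rule minus_carrier_mat\<close>)
  then have "B + (A - B) \<in> W" using Toep W B unfolding matrix_subspace_def by blast
  moreover have "B + (A - B) = A" using A Wc[OF B] by (intro eq_matI) auto
  ultimately show "A \<in> W" by simp
qed

section \<open>A point with surjective differential\<close>

lemma Toep_tuples_carrier: "Ts \<in> Toep_tuples n r \<Longrightarrow> set Ts \<subseteq> carrier_mat n n"
  by (auto simp: Toep_tuples_def dest: Toep_carrier)

lemma map2_Toep_tuples: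
  assumes "Xs \<in> Toep_tuples n r" "Ys \<in> Toep_tuples n r"
    and f: "\<And>X Y. X \<in> Toep n \<Longrightarrow> Y \<in> Toep n \<Longrightarrow> f X Y \<in> Toep n"
  shows "map2 f Xs Ys \<in> Toep_tuples n r"
proof -
  have "f X Y \<in> Toep n" if "(X, Y) \<in> set (zip Xs Ys)" for X Y
    using set_zip_leftD[OF that] set_zip_rightD[OF that] assms(1,2)
    by (intro f) (auto simp: Toep_tuples_def)
  then show ?thesis using assms(1,2) by (auto simp: Toep_tuples_def)
qed

lemma differential_image_subspace:
  assumes Ts: "Ts \<in> Toep_tuples n r"
  shows "matrix_subspace n (mat_prod_differential n Ts ` Toep_tuples n r)"
proof -
  let ?L = "mat_prod_differential n Ts" and ?D = "Toep_tuples n r"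
  have len: "length Xs = length Ts" if "Xs \<in> ?D" for Xs
    using that Ts by (simp add: Toep_tuples_def)
  have "replicate (length Ts) (0\<^sub>m n n) \<in> ?D"
    using Ts Toep_zero by (auto simp: Toep_tuples_def)
  then have "0\<^sub>m n n \<in> ?L ` ?D"
    using mat_prod_differential_zero[OF Toep_tuples_carrier[OF Ts]] by (metis image_eqI)
  moreover have "?L Xs + ?L Ys \<in> ?L ` ?D" if "Xs \<in> ?D" "Ys \<in> ?D" for Xs Ys
  proof -
    have "map2 (+) Xs Ys \<in> ?D"
      using that by (intro map2_Toep_tuples Toep_add)
    moreover have "?L (map2 (+) Xs Ys) = ?L Xs + ?L Ys"
      using that Ts by (intro mat_prod_differential_add len Toep_tuples_carrier)
    ultimately show ?thesis by (metis image_eqI)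
  qed
  moreover have "c \<cdot>\<^sub>m ?L Xs \<in> ?L ` ?D" if "Xs \<in> ?D" for c Xs
  proof -
    have "map ((\<cdot>\<^sub>m) c) Xs \<in> ?D"
      using that by (auto simp: Toep_tuples_def intro!: Toep_smult)
    moreover have "?L (map ((\<cdot>\<^sub>m) c) Xs) = c \<cdot>\<^sub>m ?L Xs"
      using that Ts by (intro mat_prod_differential_smult len Toep_tuples_carrier)
    ultimately show ?thesis by (metis image_eqI)
  qed
  moreover have "?L ` ?D \<subseteq> carrier_mat n n"
    using mat_prod_differential_carrier[OF len Toep_tuples_carrier[OF Ts] Toep_tuples_carrier]
    by blast
  ultimately show ?thesis unfolding matrix_subspace_def by blast
qed

lemma differential_image_single:
  assumes "Ts \<in> Toep_tuples n r" "X \<in> Toep n" "j < r"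
  shows "mat_prod n (take j Ts) * X * mat_prod n (drop (Suc j) Ts)
    \<in> mat_prod_differential n Ts ` Toep_tuples n r"
proof -
  have "(replicate (length Ts) (0\<^sub>m n n))[j := X] \<in> Toep_tuples n r"
    using assms Toep_zero set_update_subset_insert[of "replicate (length Ts) (0\<^sub>m n n)" j X]
    by (auto simp: Toep_tuples_def)
  moreover have "j < length Ts" using assms by (simp add: Toep_tuples_def)
  ultimately show ?thesis
    using mat_prod_differential_single[OF Toep_tuples_carrier[OF assms(1)] Toep_carrier[OF assms(2)]]
    by (metis image_eqI)
qed

text \<open>
  Perturbing two neighbouring factors in opposite directions: the contributions of \<open>Y\<close> at position \<open>j\<close> and
  of \<open>-Y\<close> at position \<open>j + 1\<close> nearly cancel.
\<close>

lemma differential_image_commutator: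
  assumes Ts: "Ts \<in> Toep_tuples n r" and Y: "Y \<in> Toep n" and j: "Suc j < r"
  shows "mat_prod n (take j Ts) * (Y * Ts ! Suc j - Ts ! j * Y) * mat_prod n (drop (Suc (Suc j)) Ts)
    \<in> mat_prod_differential n Ts ` Toep_tuples n r"
proof -
  define P Q T T' where "P = mat_prod n (take j Ts)" and "Q = mat_prod n (drop (Suc (Suc j)) Ts)"
    and "T = Ts ! j" and "T' = Ts ! Suc j"
  have len: "length Ts = r" and sub: "set Ts \<subseteq> carrier_mat n n"
    using Ts Toep_tuples_carrier[OF Ts] by (auto simp: Toep_tuples_def)
  have c: "P \<in> carrier_mat n n" "Q \<in> carrier_mat n n" "T \<in> carrier_mat n n" "T' \<in> carrier_mat n n"
    "Y \<in> carrier_mat n n"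
    unfolding P_def Q_def T_def T'_def
    using sub len j set_take_subset[of j Ts] set_drop_subset[of "Suc (Suc j)" Ts] Toep_carrier[OF Y]
    by (auto intro!: mat_prod_carrier)
  have "drop (Suc j) Ts = T' # drop (Suc (Suc j)) Ts"
    unfolding T'_def using len j by (simp add: Cons_nth_drop_Suc)
  then have right: "mat_prod n (drop (Suc j) Ts) = T' * Q" by (simp add: Q_def)
  have "mat_prod n (take (Suc j) Ts) = mat_prod n (take j Ts @ [T])"
    unfolding T_def using len j by (simp add: take_Suc_conv_app_nth)
  also have "\<dots> = P * T"
    using sub set_take_subset[of j Ts] c by (subst mat_prod_append) (auto simp: P_def)
  finally have left: "mat_prod n (take (Suc j) Ts) = P * T" .
  have "P * Y * (T' * Q) - P * T * Y * Q \<in> mat_prod_differential n Ts ` Toep_tuples n r"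
    using differential_image_single[OF Ts Y, of j] differential_image_single[OF Ts Y j] j
    unfolding right left Q_def[symmetric] P_def[symmetric]
    by (intro matrix_subspace_diff[OF differential_image_subspace[OF Ts]]) auto
  also have "P * Y * (T' * Q) - P * T * Y * Q = P * (Y * T' - T * Y) * Q"
    using c by (simp add: assoc_mult_mat[of _ n n _ n _ n] mult_carrier_mat[of _ n n _ n]
        minus_carrier_mat mult_minus_distrib_mat[of _ n n _ n] minus_mult_distrib_mat[of _ n n _ _ n])
  finally show ?thesis unfolding P_def Q_def T_def T'_def .
qed

lemma mat_prod_replicate_one: "mat_prod n (replicate k (1\<^sub>m n)) = 1\<^sub>m n"
  by (induction k) auto

text \<open>
  Take \<open>T\<^sub>k = 1 + \<epsilon> S\<^sub>k\<close> with the chain of Toeplitz matrices \<open>S\<^sub>k\<close> above. For \<open>\<epsilon> \<noteq> 0\<close> the image of the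
  differential contains matrices tending to any given Toeplitz matrix, and, after division by \<open>\<epsilon>\<close>, matrices
  tending to each \<open>Y S\<^sub>k\<^sub>+\<^sub>1 - S\<^sub>k Y\<close>. So every matrix is a limit, as \<open>\<epsilon> \<rightarrow> 0\<close>, of image elements depending
  polynomially on \<open>\<epsilon>\<close>. Doing this for the elementary matrices yields families that span for some
  \<open>\<epsilon> \<noteq> 0\<close>, because spanning is an open condition.
\<close>

lemma exists_surjective_differential:
  assumes "n \<ge> 1" "r \<ge> n div 2 + 1"
  shows "\<exists>\<tau>\<in>Toep_tuples n r. mat_prod_differential n \<tau> ` Toep_tuples n r = carrier_mat n n"
proof -
  obtain N where n: "n = Suc N" using assms(1) by (cases n) auto
  define S where "S k = toeplitz n (chain_symbol N k)" for k
  have S: "S k \<in> carrier_mat n n" "S k \<in> Toep n" for k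
    unfolding S_def by (simp_all add: toeplitz_in_Toep)
  define E where "E k \<epsilon> = 1\<^sub>m n + \<epsilon> \<cdot>\<^sub>m S k" for k and \<epsilon> :: complex
  define \<tau> where "\<tau> \<epsilon> = map (\<lambda>k. E k \<epsilon>) [0..<r]" for \<epsilon>
  define I where "I \<epsilon> = mat_prod_differential n (\<tau> \<epsilon>) ` Toep_tuples n r" for \<epsilon>
  have \<tau>: "\<tau> \<epsilon> \<in> Toep_tuples n r" for \<epsilon>
    unfolding \<tau>_def E_def by (auto simp: Toep_tuples_def intro!: Toep_add Toep_one Toep_smult S)
  have I: "matrix_subspace n (I \<epsilon>)" for \<epsilon>
    unfolding I_def by (rule differential_image_subspace[OF \<tau>])
  have E0: "E k 0 = 1\<^sub>m n" for k unfolding E_def using S(1)[of k] by (intro eq_matI) auto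
  have E: "polynomial_matrix {\<lambda>t. t} UNIV n (E k)" for k
    unfolding E_def
    by (intro polynomial_matrix_add polynomial_matrix_smult polynomial_matrix_const
        polynomial_functions.coord S) auto
  have take: "polynomial_matrix {\<lambda>t. t} UNIV n (\<lambda>\<epsilon>. mat_prod n (take j (\<tau> \<epsilon>)))" for j
    using polynomial_matrix_mat_prod[of "take j (map E [0..<r])" "{\<lambda>t. t}" UNIV n] E
    by (auto simp: \<tau>_def take_map o_def dest: in_set_takeD)
  have drop: "polynomial_matrix {\<lambda>t. t} UNIV n (\<lambda>\<epsilon>. mat_prod n (drop j (\<tau> \<epsilon>)))" for j
    using polynomial_matrix_mat_prod[of "drop j (map E [0..<r])" "{\<lambda>t. t}" UNIV n] E
    by (auto simp: \<tau>_def drop_map o_def dest: in_set_dropD)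
  have ones: "mat_prod n (take j (\<tau> 0)) = 1\<^sub>m n" "mat_prod n (drop j (\<tau> 0)) = 1\<^sub>m n" for j
    by (simp_all add: \<tau>_def E0 map_replicate_const mat_prod_replicate_one)
  \<comment> \<open>\<open>W\<close>: the polynomial limits, as \<open>\<epsilon> \<rightarrow> 0\<close>, of elements of the images \<open>I \<epsilon>\<close>.\<close>
  define W where "W = {B. \<exists>N. polynomial_matrix {\<lambda>t. t} UNIV n N \<and> N 0 = B \<and>
    (\<forall>\<epsilon>. \<epsilon> \<noteq> 0 \<longrightarrow> N \<epsilon> \<in> I \<epsilon>)}"
  have WI: "N 0 \<in> W" if "polynomial_matrix {\<lambda>t. t} UNIV n N" "\<And>\<epsilon>. \<epsilon> \<noteq> 0 \<Longrightarrow> N \<epsilon> \<in> I \<epsilon>" for N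
    using that unfolding W_def by blast
  have "matrix_subspace n W"
    unfolding matrix_subspace_def
  proof (intro conjI subsetI ballI allI)
    fix B assume "B \<in> W"
    then obtain N where N: "polynomial_matrix {\<lambda>t. t} UNIV n N" "N 0 = B" unfolding W_def by blast
    show "B \<in> carrier_mat n n" using polynomial_matrix_carrier[OF N(1), of 0] N(2) by simp
  next
    show "0\<^sub>m n n \<in> W"
      by (rule WI[of "\<lambda>_. 0\<^sub>m n n"])
        (use I in \<open>auto simp: matrix_subspace_def intro: polynomial_matrix_const\<close>)
  next
    fix A B assume "A \<in> W" "B \<in> W"
    then obtain M N where M: "polynomial_matrix {\<lambda>t. t} UNIV n M" "M 0 = A" "\<And>\<epsilon>. \<epsilon> \<noteq> 0 \<Longrightarrow> M \<epsilon> \<in> I \<epsilon>"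
      and N: "polynomial_matrix {\<lambda>t. t} UNIV n N" "N 0 = B" "\<And>\<epsilon>. \<epsilon> \<noteq> 0 \<Longrightarrow> N \<epsilon> \<in> I \<epsilon>"
      unfolding W_def by blast
    have "M 0 + N 0 \<in> W"
    proof (rule WI[of "\<lambda>\<epsilon>. M \<epsilon> + N \<epsilon>"])
      show "polynomial_matrix {\<lambda>t. t} UNIV n (\<lambda>\<epsilon>. M \<epsilon> + N \<epsilon>)"
        by (rule polynomial_matrix_add[OF M(1) N(1)])
      show "M \<epsilon> + N \<epsilon> \<in> I \<epsilon>" if "\<epsilon> \<noteq> 0" for \<epsilon>
        using I M(3)[OF that] N(3)[OF that] unfolding matrix_subspace_def by blast
    qed
    then show "A + B \<in> W" using M(2) N(2) by simp
  next
    fix c A assume "A \<in> W"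
    then obtain M where M: "polynomial_matrix {\<lambda>t. t} UNIV n M" "M 0 = A" "\<And>\<epsilon>. \<epsilon> \<noteq> 0 \<Longrightarrow> M \<epsilon> \<in> I \<epsilon>"
      unfolding W_def by blast
    have "c \<cdot>\<^sub>m M 0 \<in> W"
    proof (rule WI[of "\<lambda>\<epsilon>. c \<cdot>\<^sub>m M \<epsilon>"])
      show "polynomial_matrix {\<lambda>t. t} UNIV n (\<lambda>\<epsilon>. c \<cdot>\<^sub>m M \<epsilon>)"
        by (rule polynomial_matrix_smult[OF polynomial_functions.const M(1)])
      show "c \<cdot>\<^sub>m M \<epsilon> \<in> I \<epsilon>" if "\<epsilon> \<noteq> 0" for \<epsilon>
        using I M(3)[OF that] unfolding matrix_subspace_def by blast
    qed
    then show "c \<cdot>\<^sub>m A \<in> W" using M(2) by simp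
  qed
  moreover have "Toep n \<subseteq> W"
  proof
    fix X assume X: "X \<in> Toep n"
    note Xc = Toep_carrier[OF X]
    have "(1\<^sub>m n * X) * mat_prod n (drop (Suc 0) (\<tau> 0)) \<in> W"
    proof (rule WI[of "\<lambda>\<epsilon>. (1\<^sub>m n * X) * mat_prod n (drop (Suc 0) (\<tau> \<epsilon>))"])
      show "polynomial_matrix {\<lambda>t. t} UNIV n (\<lambda>\<epsilon>. (1\<^sub>m n * X) * mat_prod n (drop (Suc 0) (\<tau> \<epsilon>)))"
        using Xc by (intro polynomial_matrix_mult polynomial_matrix_const drop) auto
      show "(1\<^sub>m n * X) * mat_prod n (drop (Suc 0) (\<tau> \<epsilon>)) \<in> I \<epsilon>" for \<epsilon>
        using differential_image_single[OF \<tau> X, of 0] assms(2) unfolding I_def by simp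
    qed
    then show "X \<in> W" using Xc by (simp add: ones)
  qed
  moreover have "Y * S (Suc k) - S k * Y \<in> W" if Y: "Y \<in> Toep n" and k: "k < n div 2" for Y k
  proof -
    note Yc = Toep_carrier[OF Y]
    let ?C = "Y * S (Suc k) - S k * Y"
    let ?M = "\<lambda>\<epsilon>. mat_prod n (take k (\<tau> \<epsilon>)) * ?C * mat_prod n (drop (Suc (Suc k)) (\<tau> \<epsilon>))"
    have C: "?C \<in> carrier_mat n n" using Yc S(1) by (intro minus_carrier_mat mult_carrier_mat)
    have "?M 0 \<in> W"
    proof (rule WI[of ?M])
      show "polynomial_matrix {\<lambda>t. t} UNIV n ?M"
        by (intro polynomial_matrix_mult polynomial_matrix_const take drop C)
      fix \<epsilon> :: complex assume \<epsilon>: "\<epsilon> \<noteq> 0"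
      have "\<tau> \<epsilon> ! Suc k = E (Suc k) \<epsilon>" "\<tau> \<epsilon> ! k = E k \<epsilon>"
        unfolding \<tau>_def using k assms(2) by (auto simp: nth_append)
      moreover have "Y * E (Suc k) \<epsilon> - E k \<epsilon> * Y = \<epsilon> \<cdot>\<^sub>m ?C"
      proof -
        have "Y * E (Suc k) \<epsilon> = Y + \<epsilon> \<cdot>\<^sub>m (Y * S (Suc k))"
          unfolding E_def using Yc S(1)[of "Suc k"]
          by (simp add: mult_add_distrib_mat[of _ n n _ n] mult_smult_distrib[of _ n n _ n])
        moreover have "E k \<epsilon> * Y = Y + \<epsilon> \<cdot>\<^sub>m (S k * Y)"
          unfolding E_def using Yc S(1)[of k]
          by (simp add: add_mult_distrib_mat[of _ n n _ _ n] mult_smult_assoc_mat[of _ n n _ n])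
        ultimately show ?thesis
          using Yc S(1)[of k] S(1)[of "Suc k"]
          by (intro eq_matI) (auto simp: right_diff_distrib)
      qed
      ultimately have "mat_prod n (take k (\<tau> \<epsilon>)) * (\<epsilon> \<cdot>\<^sub>m ?C) *
          mat_prod n (drop (Suc (Suc k)) (\<tau> \<epsilon>)) \<in> I \<epsilon>"
        using differential_image_commutator[OF \<tau> Y, of k \<epsilon>] k assms(2) unfolding I_def by simp
      then have "(1 / \<epsilon>) \<cdot>\<^sub>m (mat_prod n (take k (\<tau> \<epsilon>)) * (\<epsilon> \<cdot>\<^sub>m ?C) *
          mat_prod n (drop (Suc (Suc k)) (\<tau> \<epsilon>))) \<in> I \<epsilon>"
        using I[of \<epsilon>] unfolding matrix_subspace_def by blast
      also have "mat_prod n (take k (\<tau> \<epsilon>)) * (\<epsilon> \<cdot>\<^sub>m ?C) * mat_prod n (drop (Suc (Suc k)) (\<tau> \<epsilon>)) =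
          \<epsilon> \<cdot>\<^sub>m ?M \<epsilon>"
        using C polynomial_matrix_carrier[OF take[of k], of \<epsilon>]
          polynomial_matrix_carrier[OF drop[of "Suc (Suc k)"], of \<epsilon>]
        by (simp add: mult_smult_distrib[of _ n n _ n] mult_smult_assoc_mat[of _ n n _ n]
            mult_carrier_mat[of _ n n _ n])
      also have "(1 / \<epsilon>) \<cdot>\<^sub>m (\<epsilon> \<cdot>\<^sub>m ?M \<epsilon>) = ?M \<epsilon>"
        using \<epsilon> by (intro eq_matI) auto
      finally show "?M \<epsilon> \<in> I \<epsilon>" .
    qed
    then show ?thesis unfolding ones left_mult_one_mat[OF C] right_mult_one_mat[OF C] .
  qed
  ultimately have "carrier_mat n n \<subseteq> W"
    unfolding n S_def by (intro toeplitz_commutators_generate) auto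
  then have "matrix_unit n k \<in> W" for k by (auto simp: matrix_unit_def)
  then have "\<forall>k. \<exists>N. polynomial_matrix {\<lambda>t. t} UNIV n N \<and> N 0 = matrix_unit n k \<and>
      (\<forall>\<epsilon>. \<epsilon> \<noteq> 0 \<longrightarrow> N \<epsilon> \<in> I \<epsilon>)" unfolding W_def by blast
  then obtain M where M: "\<And>k. polynomial_matrix {\<lambda>t. t} UNIV n (M k)"
    "\<And>k. M k 0 = matrix_unit n k" "\<And>k \<epsilon>. \<epsilon> \<noteq> 0 \<Longrightarrow> M k \<epsilon> \<in> I \<epsilon>" by metis
  obtain g where g: "g \<in> polynomial_functions {\<lambda>t. t}" "g 0 \<noteq> 0"
    and span: "\<And>\<epsilon> I. g \<epsilon> \<noteq> 0 \<Longrightarrow> matrix_subspace n I \<Longrightarrow> \<forall>k<n * n. M k \<epsilon> \<in> I \<Longrightarrow> carrier_mat n n \<subseteq> I"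
    using spanning_near_matrix_units[of n "{\<lambda>t. t}" UNIV M 0] M(1,2) by auto
  obtain \<epsilon> where \<epsilon>: "\<epsilon> \<noteq> 0" "g \<epsilon> \<noteq> 0"
    using polynomial_function_eq_0_by_continuity[OF g(1)] g(2) by blast
  have "carrier_mat n n \<subseteq> I \<epsilon>" using span[OF \<epsilon>(2) I] M(3)[OF \<epsilon>(1)] by blast
  then have "I \<epsilon> = carrier_mat n n" using I[of \<epsilon>] unfolding matrix_subspace_def by blast
  then show ?thesis using \<tau> unfolding I_def by blast
qed

section \<open>Generic rank and generic factorization\<close>

lemma polynomial_matrix_Toep_entry:
  assumes "k < r"
  shows "polynomial_matrix (tuple_coords n r) (Toep_tuples n r) n (\<lambda>Ts. Ts ! k)"
  unfolding polynomial_matrix_def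
proof (intro conjI allI impI ballI)
  fix Ts assume "Ts \<in> Toep_tuples n r"
  then show "Ts ! k \<in> carrier_mat n n"
    using assms Toep_tuples_carrier[of Ts n r] by (auto simp: Toep_tuples_def)
next
  fix i j assume "i < n" "j < n"
  then have "(\<lambda>Ts. Ts ! k $$ (i, j)) \<in> tuple_coords n r"
    using assms unfolding tuple_coords_def by blast
  then show "\<exists>f\<in>polynomial_functions (tuple_coords n r).
      \<forall>Ts\<in>Toep_tuples n r. Ts ! k $$ (i, j) = f Ts"
    by (intro bexI[of _ "\<lambda>Ts. Ts ! k $$ (i, j)"] polynomial_functions.coord) auto
qed

text \<open>
  Choose preimages of the elementary matrices at \<open>\<tau>\<^sub>0\<close> and keep them fixed while \<open>\<tau>\<close> varies.
\<close>

lemma generic_full_rank: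
  assumes "\<tau>\<^sub>0 \<in> Toep_tuples n r" "mat_prod_differential n \<tau>\<^sub>0 ` Toep_tuples n r = carrier_mat n n"
  shows "generic (tuple_coords n r) (Toep_tuples n r)
    (\<lambda>\<tau>. rank_on n (Toep_tuples n r) (mat_prod_differential n \<tau>) = n\<^sup>2)"
proof -
  have "\<forall>k. \<exists>Xs\<in>Toep_tuples n r. mat_prod_differential n \<tau>\<^sub>0 Xs = matrix_unit n k"
    using assms(2) by (metis image_iff mat_carrier matrix_unit_def)
  then obtain X where X: "\<And>k. X k \<in> Toep_tuples n r"
    "\<And>k. mat_prod_differential n \<tau>\<^sub>0 (X k) = matrix_unit n k" by metis
  have poly: "polynomial_matrix (tuple_coords n r) (Toep_tuples n r) n
      (\<lambda>\<tau>. mat_prod_differential n \<tau> (X k))" for k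
  proof (rule polynomial_matrix_cong)
    let ?entries = "map (\<lambda>j Ts. Ts ! j) [0..<r]"
    show "polynomial_matrix (tuple_coords n r) (Toep_tuples n r) n
        (\<lambda>\<tau>. mat_prod_differential n (map (\<lambda>N. N \<tau>) ?entries) (X k))"
    proof (rule polynomial_matrix_differential)
      show "length (X k) = length ?entries" using X(1)[of k] by (simp add: Toep_tuples_def)
      show "set (X k) \<subseteq> carrier_mat n n" by (rule Toep_tuples_carrier[OF X(1)])
    qed (auto intro: polynomial_matrix_Toep_entry)
    fix \<tau> assume "\<tau> \<in> Toep_tuples n r"
    then have "map (\<lambda>N. N \<tau>) ?entries = \<tau>"
      by (auto simp: Toep_tuples_def intro!: nth_equalityI)
    then show "mat_prod_differential n \<tau> (X k) =
        mat_prod_differential n (map (\<lambda>N. N \<tau>) ?entries) (X k)" by simp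
  qed
  obtain g where g: "g \<in> polynomial_functions (tuple_coords n r)" "g \<tau>\<^sub>0 \<noteq> 0"
    and span: "\<And>\<tau> I. \<tau> \<in> Toep_tuples n r \<Longrightarrow> g \<tau> \<noteq> 0 \<Longrightarrow> matrix_subspace n I \<Longrightarrow>
      \<forall>k<n * n. mat_prod_differential n \<tau> (X k) \<in> I \<Longrightarrow> carrier_mat n n \<subseteq> I"
    using spanning_near_matrix_units[OF poly assms(1) X(2)] by blast
  show ?thesis
  proof (rule generic_if_nonvanishing[OF g(1) assms(1) g(2)])
    fix \<tau> assume \<tau>: "\<tau> \<in> Toep_tuples n r" "g \<tau> \<noteq> 0"
    note I = differential_image_subspace[OF \<tau>(1)]
    have "carrier_mat n n \<subseteq> mat_prod_differential n \<tau> ` Toep_tuples n r"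
      using span[OF \<tau> I] X(1) by blast
    then show "rank_on n (Toep_tuples n r) (mat_prod_differential n \<tau>) = n\<^sup>2"
      using I unfolding matrix_subspace_def by (intro rank_on_surjective equalityI) auto
  qed
qed

text \<open>
  Lines through \<open>\<tau>\<^sub>0\<close> are mapped to curves through its product in all directions, so the product map is
  dominant. The map is parametrized by the symbols of the factors; \<open>e (k, d)\<close> is the entry
  of the \<open>k\<close>-th factor on the diagonal \<open>d\<close>.
\<close>

lemma generic_product:
  assumes \<tau>0: "\<tau>\<^sub>0 \<in> Toep_tuples n r"
    and surj: "mat_prod_differential n \<tau>\<^sub>0 ` Toep_tuples n r = carrier_mat n n"
  shows "generic (mat_coords n) (carrier_mat n n) (\<lambda>A. \<exists>Ts\<in>Toep_tuples n r. A = mat_prod n Ts)"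
proof -
  define T where "T e = map (\<lambda>k. toeplitz n (\<lambda>d. e (k, d))) [0..<r]" for e :: "nat \<times> int \<Rightarrow> complex"
  have T: "T e \<in> Toep_tuples n r" for e
    unfolding T_def by (auto simp: Toep_tuples_def toeplitz_in_Toep)
  have T_onto: "\<exists>e. Ts = T e" if Ts: "Ts \<in> Toep_tuples n r" for Ts
  proof -
    have "\<forall>k. \<exists>y. k < r \<longrightarrow> Ts ! k = toeplitz n y"
      using Ts Toep_eq_toeplitz by (auto simp: Toep_tuples_def subset_iff)
    then obtain y where "\<And>k. k < r \<Longrightarrow> Ts ! k = toeplitz n (y k)" by metis
    then have "Ts = T (\<lambda>(k, d). y k d)"
      using Ts by (auto simp: T_def Toep_tuples_def intro!: nth_equalityI)
    then show ?thesis by blast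
  qed
  have "\<exists>g\<in>polynomial_functions (mat_coords n). not_identically_zero (carrier_mat n n) g \<and>
      (\<forall>A\<in>carrier_mat n n. g A \<noteq> 0 \<longrightarrow> (\<exists>e. A = mat_prod n (T e)))"
  proof (rule dominant_image_contains_open[where V = "{..<r} \<times> {- int n..int n}"])
    fix e e' :: "nat \<times> int \<Rightarrow> complex"
    assume eq: "\<And>v. v \<in> {..<r} \<times> {- int n..int n} \<Longrightarrow> e v = e' v"
    have "T e = T e'" unfolding T_def toeplitz_def
      by (intro map_cong refl eq_matI) (auto intro!: eq)
    then show "mat_prod n (T e) = mat_prod n (T e')" by simp
  next
    have entry: "polynomial_matrix coordinates UNIV n (\<lambda>e. toeplitz n (\<lambda>d. e (k, d)))" for k :: nat
      unfolding polynomial_matrix_def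
      by (auto simp: toeplitz_def intro!: bexI[of _ "\<lambda>e. e (k, _)"] polynomial_functions.coord)
    show "polynomial_matrix coordinates UNIV n (\<lambda>e. mat_prod n (T e))"
      using polynomial_matrix_mat_prod[of "map (\<lambda>k e. toeplitz n (\<lambda>d. e (k, d))) [0..<r]"
          coordinates UNIV n] entry
      by (auto simp: T_def o_def)
  next
    fix g assume g: "g \<in> polynomial_functions (mat_coords n)" and zero: "\<And>e. g (mat_prod n (T e)) = 0"
    have "g A = 0" if "A \<in> carrier_mat n n" for A
    proof (rule polynomial_vanishing_along_all_directions[OF g _ _ that])
      show "mat_prod n \<tau>\<^sub>0 \<in> carrier_mat n n"
        by (rule mat_prod_carrier[OF Toep_tuples_carrier[OF \<tau>0]])
      fix Z :: "complex mat" assume "Z \<in> carrier_mat n n"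
      then obtain Xs where Xs: "Xs \<in> Toep_tuples n r" "mat_prod_differential n \<tau>\<^sub>0 Xs = Z"
        using surj by (metis imageE)
      have len: "length Xs = length \<tau>\<^sub>0" using Xs \<tau>0 by (simp add: Toep_tuples_def)
      obtain w where w: "polynomial_matrix {\<lambda>t. t} UNIV n w" "w 0 = Z"
        "\<And>t. mat_prod n (map2 (\<lambda>T X. T + t \<cdot>\<^sub>m X) \<tau>\<^sub>0 Xs) = mat_prod n \<tau>\<^sub>0 + t \<cdot>\<^sub>m w t"
        using mat_prod_along_line[OF len Toep_tuples_carrier[OF \<tau>0] Toep_tuples_carrier[OF Xs(1)]]
          Xs(2) by blast
      have "g (mat_prod n \<tau>\<^sub>0 + t \<cdot>\<^sub>m w t) = 0" for t
      proof -
        have "map2 (\<lambda>T X. T + t \<cdot>\<^sub>m X) \<tau>\<^sub>0 Xs \<in> Toep_tuples n r"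
          using \<tau>0 Xs(1) by (intro map2_Toep_tuples Toep_add Toep_smult)
        then obtain e where "map2 (\<lambda>T X. T + t \<cdot>\<^sub>m X) \<tau>\<^sub>0 Xs = T e" using T_onto by blast
        then show ?thesis using zero[of e] w(3)[of t] by simp
      qed
      then show "\<exists>w. polynomial_matrix {\<lambda>t. t} UNIV n w \<and> w 0 = Z \<and>
          (\<forall>t. g (mat_prod n \<tau>\<^sub>0 + t \<cdot>\<^sub>m w t) = 0)" using w(1,2) by blast
    qed
    then show "\<not> not_identically_zero (carrier_mat n n) g"
      unfolding not_identically_zero_def by blast
  qed simp
  then obtain g A where g: "g \<in> polynomial_functions (mat_coords n)" "A \<in> carrier_mat n n" "g A \<noteq> 0"
    "\<And>A. A \<in> carrier_mat n n \<Longrightarrow> g A \<noteq> 0 \<Longrightarrow> \<exists>e. A = mat_prod n (T e)"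
    unfolding not_identically_zero_def by blast
  show ?thesis
  proof (rule generic_if_nonvanishing[OF g(1-3)])
    fix B :: "complex mat" assume "B \<in> carrier_mat n n" "g B \<noteq> 0"
    then obtain e where "B = mat_prod n (T e)" using g(4) by blast
    then show "\<exists>Ts\<in>Toep_tuples n r. B = mat_prod n Ts" using T by (intro bexI[of _ "T e"]) auto
  qed
qed

theorem theorem3p1:
  fixes n :: nat
  assumes "n \<ge> 1"
  shows "(\<forall>r \<ge> n div 2 + 1.
            generic (tuple_coords n r) (Toep_tuples n r)
              (\<lambda>\<tau>. rank_on n (Toep_tuples n r) (mat_prod_differential n \<tau>) = n\<^sup>2))
       \<and> generic (mat_coords n) (carrier_mat n n)
           (\<lambda>A. \<exists>Ts \<in> Toep_tuples n (n div 2 + 1). A = mat_prod n Ts)"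
proof (intro conjI allI impI)
  fix r assume "r \<ge> n div 2 + 1"
  from exists_surjective_differential[OF assms this]
  show "generic (tuple_coords n r) (Toep_tuples n r)
      (\<lambda>\<tau>. rank_on n (Toep_tuples n r) (mat_prod_differential n \<tau>) = n\<^sup>2)"
    by (elim bexE) (rule generic_full_rank)
next
  from exists_surjective_differential[OF assms order_refl]
  show "generic (mat_coords n) (carrier_mat n n)
      (\<lambda>A. \<exists>Ts \<in> Toep_tuples n (n div 2 + 1). A = mat_prod n Ts)"
    by (elim bexE) (rule generic_product)
qed

end
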